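(* Let $\mu\in\mathbb{R}$, $\sigma>0$ be constants and $\delta,\beta,L_{max}>0$. For every $0<\alpha\le1$ and every $x>\bar x:=\ln(\alpha)/c_2$ there exists a pair $(b^*,\lambda^* )$ with $b^*\ge0$ and $\lambda^*\le0$ such that $b^*$ is the equilibrium threshold level for the parameter $\lambda^*$ (as defined in the context), and $$w(x,b^* )\le\alpha\qquad\text{and}\qquad \lambda^*\big(w(x,b^* )-\alpha\big)=0 .$$
   Context: Constants: $$a_{1,2}=-\tfrac{\mu}{\sigma^2}\pm\sqrt{\tfrac{\mu^2}{\sigma^4}+\tfrac{2\delta}{\sigma^2}},\quad b_{1,2}=-\tfrac{\mu-L_{max}}{\sigma^2}\pm\sqrt{\tfrac{(\mu-L_{max})^2}{\sigma^4}+\tfrac{2\delta}{\sigma^2}},$$ $$c_{1,2}=-\tfrac{\mu}{\sigma^2}\pm\sqrt{\tfrac{\mu^2}{\sigma^4}+\tfrac{2\beta}{\sigma^2}},\quad d_{1,2}=-\tfrac{\mu-L_{max}}{\sigma^2}\pm\sqrt{\tfrac{(\mu-L_{max})^2}{\sigma^4}+\tfrac{2\beta}{\sigma^2}}$$ (index 1 for $+$, index 2 for $-$). Constraint function: for $b\ge0$ and $x\ge0$, let $X^b$ solve $dX^b_s=(\mu-L_{max}1_{\{X^b_s\ge b\}})ds+\sigma\,dW_s$, $X^b_0=x$ ($W$ a standard Brownian motion), let $\tau^b=\inf\{s\ge0:X^b_s\le0\}$, and set $w(x,b)=\mathbb{E}[e^{-\beta\tau^b}]$ (with $e^{-\beta\cdot\infty}=0$).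 Explicitly, $$w(x,b)=\begin{cases}\dfrac{(d_2-c_2)e^{-c_1(b-x)}+(c_1-d_2)e^{-c_2(b-x)}}{(d_2-c_2)e^{-c_1b}+(c_1-d_2)e^{-c_2b}},&0\le x<b,\\[8pt]\dfrac{(c_1-c_2)e^{d_2(x-b)}}{(d_2-c_2)e^{-c_1b}+(c_1-d_2)e^{-c_2b}},&x\ge b.\end{cases}$$ Equilibrium threshold level: for $\lambda\le0$ put $$G_\lambda(b)=\frac{L_{max}}{\delta}\frac{(-b_2)(a_1e^{a_1b}-a_2e^{a_2b})}{(a_1-b_2)e^{a_1b}+(b_2-a_2)e^{a_2b}}+\lambda\frac{(c_2-c_1)d_2e^{(c_1+c_2)b}}{(d_2-c_1)e^{c_1b}+(c_2-d_2)e^{c_2b}}-1,\qquad \Lambda=\Big(1+b_2\frac{L_{max}}{\delta}\Big)\frac1{d_2}.$$ The equilibrium threshold level for the parameter $\lambda$ is $b^*_\lambda$, where $b^*_\lambda$ is the unique positive solution of $G_\lambda(b)=0$ if $\lambda<\Lambda$ (equivalently $(-b_2)L_{max}/\delta+\lambda d_2-1>0$), and $b^*_\lambda=0$ if $\lambda\ge\Lambda$. (It is the level for which the feedback control $\hat l(t,y)=L_{max}1_{\{y\ge b^*_\lambda\}}$ is the equilibrium control for the reward $J(t,y,l)=\mathbb{E}_{t,y}\big[\int_t^{\tau^l}e^{-\delta(s-t)}l(s,X^l_s)ds+\lambda(e^{-\beta(\tau^l-t)}-\alpha)\big]$, where $dX^l_s=(\mu-l(s,X^l_s))ds+\sigma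 dW_s$, $X^l_t=y$, $\tau^l$ is the first time $X^l\le 0$, and $l$ ranges over measurable feedback controls with values in $[0,L_{max}]$.) *)

theory Defs
  imports "HOL-Probability.Probability"
begin

(* The two roots r of (sigma^2 / 2) r^2 + m r - k = 0. *)

definition root_plus :: "real \<Rightarrow> real \<Rightarrow> real \<Rightarrow> real" where
  "root_plus m \<sigma> k = - (m / \<sigma>^2) + sqrt (m^2 / \<sigma>^4 + 2 * k / \<sigma>^2)"

definition root_minus :: "real \<Rightarrow> real \<Rightarrow> real \<Rightarrow> real" where
  "root_minus m \<sigma> k = - (m / \<sigma>^2) - sqrt (m^2 / \<sigma>^4 + 2 * k / \<sigma>^2)"

(* The indices (a, b, c, d, each with 1 for + and 2 for -) correspond to the drifts and rates
   a: (mu, delta), b: (mu - L, delta), c: (mu, beta), d: (mu - L, beta). *)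

definition threshold_fun ::
  "real \<Rightarrow> real \<Rightarrow> real \<Rightarrow> real \<Rightarrow> real \<Rightarrow> real \<Rightarrow> real \<Rightarrow> real" where
  "threshold_fun \<mu> \<sigma> \<delta> \<beta> L lam b =
    (let a1 = root_plus \<mu> \<sigma> \<delta>; a2 = root_minus \<mu> \<sigma> \<delta>;
         b2 = root_minus (\<mu> - L) \<sigma> \<delta>;
         c1 = root_plus \<mu> \<sigma> \<beta>; c2 = root_minus \<mu> \<sigma> \<beta>;
         d2 = root_minus (\<mu> - L) \<sigma> \<beta>
     in L / \<delta> * ((- b2) * (a1 * exp (a1 * b) - a2 * exp (a2 * b))
                 / ((a1 - b2) * exp (a1 * b) + (b2 - a2) * exp (a2 * b)))
        + lam * ((c2 - c1) * d2 * exp ((c1 + c2) * b)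
                 / ((d2 - c1) * exp (c1 * b) + (c2 - d2) * exp (c2 * b)))
        - 1)"

definition critical_multiplier :: "real \<Rightarrow> real \<Rightarrow> real \<Rightarrow> real \<Rightarrow> real \<Rightarrow> real" where
  "critical_multiplier \<mu> \<sigma> \<delta> \<beta> L =
    (1 + root_minus (\<mu> - L) \<sigma> \<delta> * (L / \<delta>)) * (1 / root_minus (\<mu> - L) \<sigma> \<beta>)"

(* "b is the equilibrium threshold level for lambda"; existence and uniqueness of the
   positive zero are not presupposed. *)

definition equilibrium_threshold ::
  "real \<Rightarrow> real \<Rightarrow> real \<Rightarrow> real \<Rightarrow> real \<Rightarrow> real \<Rightarrow> real \<Rightarrow> bool" where
  "equilibrium_threshold \<mu> \<sigma> \<delta> \<beta> L lam b \<longleftrightarrow>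
    (if lam < critical_multiplier \<mu> \<sigma> \<delta> \<beta> L
     then b > 0 \<and> threshold_fun \<mu> \<sigma> \<delta> \<beta> L lam b = 0 \<and>
          (\<forall>b'>0. threshold_fun \<mu> \<sigma> \<delta> \<beta> L lam b' = 0 \<longrightarrow> b' = b)
     else b = 0)"

(* The library's filtrations are indexed by a whole type, here real; only times t >= 0 matter,
   and any (F t) with t >= 0 extends by F t = F 0 for t < 0. *)

definition filtered_prob_space :: "'a measure \<Rightarrow> (real \<Rightarrow> 'a measure) \<Rightarrow> bool" where
  "filtered_prob_space M F \<longleftrightarrow>
    prob_space M \<and> filtration (space M) F \<and> (\<forall>t. subalgebra M (F t))"

definition continuous_adapted ::
  "'a measure \<Rightarrow> (real \<Rightarrow> 'a measure) \<Rightarrow> (real \<Rightarrow> 'a \<Rightarrow> real) \<Rightarrow> bool" where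
  "continuous_adapted M F X \<longleftrightarrow>
    (\<forall>t\<ge>0. X t \<in> borel_measurable (F t)) \<and>
    (\<forall>\<omega>\<in>space M. continuous_on {0..} (\<lambda>t. X t \<omega>))"

definition brownian_motion ::
  "'a measure \<Rightarrow> (real \<Rightarrow> 'a measure) \<Rightarrow> (real \<Rightarrow> 'a \<Rightarrow> real) \<Rightarrow> bool" where
  "brownian_motion M F W \<longleftrightarrow>
    filtered_prob_space M F \<and> continuous_adapted M F W \<and>
    (AE \<omega> in M. W 0 \<omega> = 0) \<and>
    (\<forall>s t. 0 \<le> s \<and> s < t \<longrightarrow>
       distributed M lborel (\<lambda>\<omega>. W t \<omega> - W s \<omega>) (\<lambda>y. ennreal (normal_density 0 (sqrt (t - s)) y)) \<and>
       prob_space.indep_set M (sets (F s))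
         {(\<lambda>\<omega>. W t \<omega> - W s \<omega>) -` A \<inter> space M | A. A \<in> sets borel})"

(* X_t = x + (integral over [0,t] of mu - L 1{X_s >= b}) + sigma W_t: since the noise is additive,
   the SDE only involves a pathwise Lebesgue integral. *)

definition threshold_sde_solution ::
  "'a measure \<Rightarrow> (real \<Rightarrow> 'a measure) \<Rightarrow> (real \<Rightarrow> 'a \<Rightarrow> real) \<Rightarrow>
   real \<Rightarrow> real \<Rightarrow> real \<Rightarrow> real \<Rightarrow> real \<Rightarrow> (real \<Rightarrow> 'a \<Rightarrow> real) \<Rightarrow> bool" where
  "threshold_sde_solution M F W \<mu> \<sigma> L x b X \<longleftrightarrow>
    continuous_adapted M F X \<and>
    (AE \<omega> in M. \<forall>t\<ge>0.
       X t \<omega> = x + (LBINT s:{0..t}. \<mu> - L * indicator {b..} (X s \<omega>)) + \<sigma> * W t \<omega>)"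

(* Takes the value infinity if the path never reaches (-infinity, 0]. *)

definition ruin_time :: "(real \<Rightarrow> 'a \<Rightarrow> real) \<Rightarrow> 'a \<Rightarrow> ereal" where
  "ruin_time X \<omega> = (INF s\<in>{s. 0 \<le> s \<and> X s \<omega> \<le> 0}. ereal s)"

definition discount :: "real \<Rightarrow> ereal \<Rightarrow> real" where
  "discount \<beta> t = (if t = \<infinity> then 0 else exp (- \<beta> * real_of_ereal t))"

definition ruin_transform :: "'a measure \<Rightarrow> real \<Rightarrow> (real \<Rightarrow> 'a \<Rightarrow> real) \<Rightarrow> real" where
  "ruin_transform M \<beta> X = (\<integral>\<omega>. discount \<beta> (ruin_time X \<omega>) \<partial>M)"

end

theory Submission
  imports Defs "HOL-Real_Asymp.Real_Asymp"
begin

text \<open>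
  Write \<open>w b\<close> for the ruin transform of the solution that starts in \<open>x\<close> and has threshold \<open>b\<close>.
  There are two independent ingredients, joined by the intermediate value theorem.

  The threshold equation. For \<open>lam \<le> 0\<close> the threshold function is strictly decreasing in
  \<open>b \<ge> 0\<close> (\<open>threshold_fun_strict_antimono\<close>), its value at \<open>0\<close> is positive exactly if
  \<open>lam\<close> lies below the critical multiplier, and for \<open>lam = 0\<close> its limit at infinity is negative.
  Hence \<open>lam = 0\<close> has an equilibrium threshold \<open>b0\<close>, and since the coefficient of \<open>lam\<close> is negative,
  the equation can be solved for \<open>lam\<close>: every \<open>b > b0\<close> is the equilibrium threshold of some
  \<open>lam \<le> 0\<close> (\<open>equilibrium_threshold_above\<close>). If \<open>w b0 \<le> \<alpha>\<close>, the pair \<open>(b0, 0)\<close> is a solution;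
  otherwise it suffices to find \<open>b > b0\<close> with \<open>w b = \<alpha>\<close>.

  The function \<open>w\<close>. It has to be continuous on \<open>b \<ge> 0\<close> and below \<open>\<alpha>\<close> for large \<open>b\<close>. Neither fact
  needs the closed formula for \<open>w\<close> or stochastic calculus. The noise is additive and the drift is
  nonincreasing in the state, so solutions with the same noise can be compared path by path: for
  \<open>b \<le> b'\<close>, the solutions satisfy \<open>X b \<le> X b' \<le> X b + (b' - b)\<close> (\<open>solution_comparison\<close>). Hence \<open>w\<close>
  is nonincreasing, and when \<open>X b\<close> is ruined, \<open>X b'\<close> is at most \<open>b' - b\<close> away from ruin. From there,
  \<open>exp (c * X - \<beta> * t)\<close> with a sufficiently negative \<open>c\<close> behaves like a submartingale, which shows that
  the further delay costs at most a factor \<open>exp (3 * c * (b' - b))\<close> (\<open>ruin_transform_lower\<close>).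
  So \<open>w\<close> is even Lipschitz continuous.

  For large \<open>b\<close>, the solution agrees with the Brownian motion with drift \<open>x + \<mu> * t + \<sigma> * W t\<close> until
  that process reaches \<open>b\<close>, so \<open>w b\<close> tends to the ruin transform of the latter. The martingale
  \<open>exp (r * (x + \<mu> * t + \<sigma> * W t) - \<beta> * t)\<close> with \<open>r = root_minus \<mu> \<sigma> \<beta>\<close> bounds this limit by
  \<open>exp (r * x)\<close>, which is less than \<open>\<alpha>\<close> by the assumption on \<open>x\<close>
  (\<open>ruin_transform_large_threshold\<close>).

  Both martingale arguments are carried out on a time grid of mesh \<open>h\<close>, where they reduce to
  independence of one Gaussian increment from the past. Fatou's lemma passes to the limit
  \<open>h \<rightarrow> 0\<close> (\<open>nn_integral_discount_ruin_le\<close>).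
\<close>

section \<open>The threshold equation\<close>

lemma root_quadratic:
  fixes m \<sigma> k :: real
  assumes "\<sigma> > 0" "k > 0"
  shows "\<sigma>^2 / 2 * (root_plus m \<sigma> k)^2 + m * root_plus m \<sigma> k - k = 0"
    and "\<sigma>^2 / 2 * (root_minus m \<sigma> k)^2 + m * root_minus m \<sigma> k - k = 0"
proof -
  have "0 \<le> m^2 / \<sigma>^4 + 2 * k / \<sigma>^2"
    using assms by (intro add_nonneg_nonneg) auto
  then have s: "(sqrt (m^2 / \<sigma>^4 + 2 * k / \<sigma>^2))^2 = m^2 / \<sigma>^4 + 2 * k / \<sigma>^2"
    by (rule real_sqrt_pow2)
  define s where "s = sqrt (m^2 / \<sigma>^4 + 2 * k / \<sigma>^2)"
  have s2: "s^2 * \<sigma>^4 = m^2 + 2 * k * \<sigma>^2"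
    using s assms unfolding s_def by (simp add: field_simps power2_eq_square power4_eq_xxxx)
  have "\<sigma>^2 * (\<sigma>^2 / 2 * (- (m / \<sigma>^2) + s)^2 + m * (- (m / \<sigma>^2) + s) - k) = (s^2 * \<sigma>^4 - m^2 - 2 * k * \<sigma>^2) / 2"
    using assms by (simp add: field_simps power2_eq_square power4_eq_xxxx)
  then show "\<sigma>^2 / 2 * (root_plus m \<sigma> k)^2 + m * root_plus m \<sigma> k - k = 0"
    unfolding root_plus_def s_def[symmetric] using assms s2 by auto
  have "\<sigma>^2 * (\<sigma>^2 / 2 * (- (m / \<sigma>^2) - s)^2 + m * (- (m / \<sigma>^2) - s) - k) = (s^2 * \<sigma>^4 - m^2 - 2 * k * \<sigma>^2) / 2"
    using assms by (simp add: field_simps power2_eq_square power4_eq_xxxx)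
  then show "\<sigma>^2 / 2 * (root_minus m \<sigma> k)^2 + m * root_minus m \<sigma> k - k = 0"
    unfolding root_minus_def s_def[symmetric] using assms s2 by auto
qed

lemma root_signs:
  fixes m \<sigma> k :: real
  assumes "\<sigma> > 0" "k > 0"
  shows root_plus_pos: "root_plus m \<sigma> k > 0" and root_minus_neg: "root_minus m \<sigma> k < 0"
proof -
  have "\<bar>m / \<sigma>^2\<bar> = sqrt ((m / \<sigma>^2)^2)"
    by simp
  also have "\<dots> < sqrt (m^2 / \<sigma>^4 + 2 * k / \<sigma>^2)"
    using assms by (intro real_sqrt_less_mono) (simp add: power_divide)
  finally have "\<bar>m / \<sigma>^2\<bar> < sqrt (m^2 / \<sigma>^4 + 2 * k / \<sigma>^2)" .
  then show "root_plus m \<sigma> k > 0" "root_minus m \<sigma> k < 0"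
    unfolding root_plus_def root_minus_def abs_less_iff by linarith+
qed

lemma root_minus_antimono_drift:
  fixes m m' \<sigma> k :: real
  assumes "\<sigma> > 0" "k > 0" "m' < m"
  shows "root_minus m \<sigma> k < root_minus m' \<sigma> k"
proof (rule ccontr)
  assume "\<not> ?thesis"
  then have le: "root_minus m' \<sigma> k \<le> root_minus m \<sigma> k" by simp
  define r r' where "r = root_minus m \<sigma> k" and "r' = root_minus m' \<sigma> k"
  have neg: "r < 0" "r' < 0" using root_minus_neg assms r_def r'_def by auto
  have q: "\<sigma>^2 / 2 * r^2 + m * r = k" "\<sigma>^2 / 2 * r'^2 + m' * r' = k"
    using root_quadratic(2) assms r_def r'_def by (auto simp: algebra_simps)
  \<comment> \<open>Dividing the quadratic equation by its root makes the drift comparable.\<close>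
  have "\<sigma>^2 / 2 * r + m = k / r" "\<sigma>^2 / 2 * r' + m' = k / r'"
    using q neg by (auto simp: field_simps power2_eq_square)
  moreover have "k / r \<le> k / r'"
    using le neg assms unfolding r_def[symmetric] r'_def[symmetric]
    by (simp add: divide_left_mono mult_neg_neg)
  moreover have "\<sigma>^2 / 2 * r' \<le> \<sigma>^2 / 2 * r"
    using le unfolding r_def r'_def by (intro mult_left_mono) auto
  ultimately show False using assms(3) by linarith
qed

text \<open>The first term of the threshold function, without the factor \<open>L / \<delta>\<close>.\<close>

definition reward_term :: "real \<Rightarrow> real \<Rightarrow> real \<Rightarrow> real \<Rightarrow> real" where
  "reward_term a1 a2 b2 b =
     (- b2) * (a1 * exp (a1 * b) - a2 * exp (a2 * b))
       / ((a1 - b2) * exp (a1 * b) + (b2 - a2) * exp (a2 * b))"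

text \<open>The coefficient of the multiplier in the threshold function.\<close>

definition constraint_term :: "real \<Rightarrow> real \<Rightarrow> real \<Rightarrow> real \<Rightarrow> real" where
  "constraint_term c1 c2 d2 b =
     (c2 - c1) * d2 * exp ((c1 + c2) * b) / ((d2 - c1) * exp (c1 * b) + (c2 - d2) * exp (c2 * b))"

lemma reward_term_strict_antimono:
  assumes "a1 > 0" "a2 < b2" "b2 < 0" "b < b'"
  shows "reward_term a1 a2 b2 b' < reward_term a1 a2 b2 b"
proof -
  define E F E' F' where "E = exp (a1 * b)" "F = exp (a2 * b)" "E' = exp (a1 * b')" "F' = exp (a2 * b')"
  note d = E_F_E'_F'_def
  have pos: "E > 0" "F > 0" "E' > 0" "F' > 0" by (auto simp: d)
  have den: "(a1 - b2) * E + (b2 - a2) * F > 0" "(a1 - b2) * E' + (b2 - a2) * F' > 0"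
    using assms pos by (auto intro!: add_pos_pos mult_pos_pos)
  have "E < E'" "F' < F" using assms by (auto simp: d)
  then have "E * F' < E' * F" using pos by (intro mult_strict_mono) auto
  then have "(E' * F - E * F') * (b2 * (a1 - a2)) < 0"
    using assms by (intro mult_pos_neg mult_neg_pos) auto
  moreover have "(a1 * E' - a2 * F') * ((a1 - b2) * E + (b2 - a2) * F)
      - (a1 * E - a2 * F) * ((a1 - b2) * E' + (b2 - a2) * F') = (E' * F - E * F') * (b2 * (a1 - a2))"
    by (simp add: algebra_simps)
  ultimately have "(a1 * E' - a2 * F') * ((a1 - b2) * E + (b2 - a2) * F)
      < (a1 * E - a2 * F) * ((a1 - b2) * E' + (b2 - a2) * F')" by linarith
  then have "(a1 * E' - a2 * F') / ((a1 - b2) * E' + (b2 - a2) * F')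
      < (a1 * E - a2 * F) / ((a1 - b2) * E + (b2 - a2) * F)"
    using den by (simp add: field_simps)
  then have "(- b2) * ((a1 * E' - a2 * F') / ((a1 - b2) * E' + (b2 - a2) * F'))
      < (- b2) * ((a1 * E - a2 * F) / ((a1 - b2) * E + (b2 - a2) * F))"
    using assms by (intro mult_strict_left_mono) auto
  then show ?thesis unfolding reward_term_def d by simp
qed

lemma reward_term_isCont:
  assumes "a1 > 0" "a2 < b2" "b2 < 0"
  shows "isCont (reward_term a1 a2 b2) b"
proof -
  have "(a1 - b2) * exp (a1 * b) + (b2 - a2) * exp (a2 * b) > 0"
    using assms by (intro add_pos_pos mult_pos_pos) auto
  then show ?thesis unfolding reward_term_def by (intro continuous_intros) auto
qed

lemma reward_term_tendsto:
  assumes "a1 > 0" "a2 < b2" "b2 < 0"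
  shows "(reward_term a1 a2 b2 \<longlongrightarrow> (- b2) * a1 / (a1 - b2)) at_top"
proof -
  have "filterlim (\<lambda>b. (a2 - a1) * b) at_bot at_top"
    using assms by (intro filterlim_tendsto_neg_mult_at_bot[OF tendsto_const _ filterlim_ident]) auto
  then have u: "((\<lambda>b. exp ((a2 - a1) * b)) \<longlongrightarrow> 0) at_top"
    by (rule filterlim_compose[OF exp_at_bot])
  have "((\<lambda>b. (- b2) * (a1 - a2 * exp ((a2 - a1) * b))
      / ((a1 - b2) + (b2 - a2) * exp ((a2 - a1) * b)))
          \<longlongrightarrow> (- b2) * (a1 - a2 * 0) / ((a1 - b2) + (b2 - a2) * 0)) at_top"
    using assms by (intro tendsto_intros u) auto
  moreover have "(- b2) * (a1 - a2 * exp ((a2 - a1) * b)) / ((a1 - b2) + (b2 - a2) * exp ((a2 - a1) * b))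
      = reward_term a1 a2 b2 b" for b
  proof -
    have "exp (a2 * b) = exp ((a2 - a1) * b) * exp (a1 * b)"
      by (simp add: exp_add[symmetric] algebra_simps)
    then have "reward_term a1 a2 b2 b = (exp (a1 * b) * ((- b2) * (a1 - a2 * exp ((a2 - a1) * b))))
        / (exp (a1 * b) * ((a1 - b2) + (b2 - a2) * exp ((a2 - a1) * b)))"
      unfolding reward_term_def by (simp add: algebra_simps)
    then show ?thesis by simp
  qed
  ultimately show ?thesis by simp
qed

lemma constraint_term_neg:
  assumes "c1 > 0" "c2 < d2" "d2 < 0"
  shows "constraint_term c1 c2 d2 b < 0"
proof -
  have "(d2 - c1) * exp (c1 * b) + (c2 - d2) * exp (c2 * b) < 0"
    using assms by (intro add_neg_neg mult_neg_pos) auto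
  moreover have "(c2 - c1) * d2 * exp ((c1 + c2) * b) > 0"
    using assms by (intro mult_pos_pos mult_neg_neg) auto
  ultimately show ?thesis unfolding constraint_term_def by (rule divide_pos_neg[rotated])
qed

lemma constraint_term_strict_mono:
  assumes "c1 > 0" "c2 < d2" "d2 < 0" "0 \<le> b" "b < b'"
  shows "constraint_term c1 c2 d2 b < constraint_term c1 c2 d2 b'"
proof -
  \<comment> \<open>Dividing numerator and denominator by \<open>exp ((c1 + c2) * t)\<close> leaves \<open>t\<close> only in the denominator \<open>D\<close>.\<close>
  define D where "D = (\<lambda>t::real. (c1 - d2) * exp (- c2 * t) + (d2 - c2) * exp (- c1 * t))"
  have eq: "constraint_term c1 c2 d2 t = - ((c2 - c1) * d2 / D t)" for t
  proof -
    have e: "exp ((c1 + c2) * t) * exp (- c2 * t) = exp (c1 * t)"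
        "exp ((c1 + c2) * t) * exp (- c1 * t) = exp (c2 * t)"
      unfolding exp_add[symmetric] by (simp_all add: algebra_simps)
    have "E * (- ((c1 - d2) * P + (d2 - c2) * Q)) = (d2 - c1) * (E * P) + (c2 - d2) * (E * Q)" for E P Q :: real
      by algebra
    then have "exp ((c1 + c2) * t) * (- D t) = (d2 - c1) * (exp ((c1 + c2) * t) * exp (- c2 * t))
        + (c2 - d2) * (exp ((c1 + c2) * t) * exp (- c1 * t))"
      unfolding D_def by blast
    also have "\<dots> = (d2 - c1) * exp (c1 * t) + (c2 - d2) * exp (c2 * t)"
      unfolding e ..
    finally have "constraint_term c1 c2 d2 t
        = ((c2 - c1) * d2 * exp ((c1 + c2) * t)) / (exp ((c1 + c2) * t) * (- D t))"
      unfolding constraint_term_def by simp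
    then show ?thesis by simp
  qed
  have Dpos: "D t > 0" for t
    unfolding D_def using assms by (intro add_pos_pos mult_pos_pos) auto
  have "D b < D b'"
  proof (rule DERIV_pos_imp_increasing_open[OF assms(5)])
    fix t assume "b < t" "t < b'"
    then have t: "0 < t" using assms by simp
    have "exp (- c1 * t) < 1" "1 < exp (- c2 * t)"
      using assms t by (auto simp: mult_neg_pos)
    then have "(c1 - d2) * (- c2) * 1 < (c1 - d2) * (- c2) * exp (- c2 * t)"
      "(d2 - c2) * (- c1) * 1 < (d2 - c2) * (- c1) * exp (- c1 * t)"
      using assms by (auto intro!: mult_strict_left_mono mult_strict_left_mono_neg mult_pos_neg
          simp del: mult_minus_right mult_minus_left)
    moreover have "(c1 - d2) * (- c2) * 1 + (d2 - c2) * (- c1) * 1 = d2 * (c2 - c1)"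
      by algebra
    moreover have "d2 * (c2 - c1) > 0" using assms by (intro mult_neg_neg) auto
    ultimately have "0 < (c1 - d2) * (- c2) * exp (- c2 * t) + (d2 - c2) * (- c1) * exp (- c1 * t)"
      by linarith
    moreover have "(D has_real_derivative
        (c1 - d2) * (exp (- c2 * t) * (- c2)) + (d2 - c2) * (exp (- c1 * t) * (- c1))) (at t)"
      unfolding D_def
      by (intro DERIV_add DERIV_cmult DERIV_fun_exp DERIV_cmult_Id)
    ultimately show "\<exists>y. (D has_real_derivative y) (at t) \<and> 0 < y"
      by (intro exI[of _ "(c1 - d2) * (exp (- c2 * t) * (- c2)) + (d2 - c2) * (exp (- c1 * t) * (- c1))"])
        (simp add: mult_ac)
  next
    show "continuous_on {b..b'} D" unfolding D_def by (intro continuous_intros)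
  qed
  moreover have "(c2 - c1) * d2 > 0" using assms by (intro mult_neg_neg) auto
  ultimately have "(c2 - c1) * d2 / D b' < (c2 - c1) * d2 / D b"
    by (rule divide_strict_left_mono) (intro mult_pos_pos Dpos)
  then show ?thesis unfolding eq by simp
qed

lemma threshold_fun_eq:
  "threshold_fun \<mu> \<sigma> \<delta> \<beta> L lam b =
     L / \<delta> * reward_term (root_plus \<mu> \<sigma> \<delta>) (root_minus \<mu> \<sigma> \<delta>) (root_minus (\<mu> - L) \<sigma> \<delta>) b
     + lam * constraint_term (root_plus \<mu> \<sigma> \<beta>) (root_minus \<mu> \<sigma> \<beta>) (root_minus (\<mu> - L) \<sigma> \<beta>) b - 1"
  unfolding threshold_fun_def reward_term_def constraint_term_def Let_def by simp

lemma threshold_fun_strict_antimono: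
  assumes "\<sigma> > 0" "\<delta> > 0" "\<beta> > 0" "L > 0" "lam \<le> 0" "0 \<le> b" "b < b'"
  shows "threshold_fun \<mu> \<sigma> \<delta> \<beta> L lam b' < threshold_fun \<mu> \<sigma> \<delta> \<beta> L lam b"
proof -
  have "constraint_term (root_plus \<mu> \<sigma> \<beta>) (root_minus \<mu> \<sigma> \<beta>) (root_minus (\<mu> - L) \<sigma> \<beta>) b
      < constraint_term (root_plus \<mu> \<sigma> \<beta>) (root_minus \<mu> \<sigma> \<beta>) (root_minus (\<mu> - L) \<sigma> \<beta>) b'"
    using assms by (intro constraint_term_strict_mono
        root_plus_pos root_minus_neg root_minus_antimono_drift) auto
  moreover have "L / \<delta> * reward_term (root_plus \<mu> \<sigma> \<delta>) (root_minus \<mu> \<sigma> \<delta>) (root_minus (\<mu> - L) \<sigma> \<delta>) b'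
      < L / \<delta> * reward_term (root_plus \<mu> \<sigma> \<delta>) (root_minus \<mu> \<sigma> \<delta>) (root_minus (\<mu> - L) \<sigma> \<delta>) b"
    using assms by (intro mult_strict_left_mono reward_term_strict_antimono
        root_plus_pos root_minus_neg root_minus_antimono_drift) auto
  ultimately show ?thesis
    unfolding threshold_fun_eq using mult_left_mono_neg[OF less_imp_le assms(5)] by (simp add: add_less_le_mono)
qed

lemma threshold_fun_at_0_pos_iff:
  assumes "\<sigma> > 0" "\<delta> > 0" "\<beta> > 0" "L > 0"
  shows "0 < threshold_fun \<mu> \<sigma> \<delta> \<beta> L lam 0 \<longleftrightarrow> lam < critical_multiplier \<mu> \<sigma> \<delta> \<beta> L"
proof -
  define b2 d2 where "b2 = root_minus (\<mu> - L) \<sigma> \<delta>" "d2 = root_minus (\<mu> - L) \<sigma> \<beta>"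
  have neg: "d2 < 0" using assms by (auto simp: b2_d2_def root_minus_neg)
  have "root_minus \<mu> \<sigma> k < root_plus \<mu> \<sigma> k" if "k > 0" for k
    using root_plus_pos[of \<sigma> k \<mu>] root_minus_neg[of \<sigma> k \<mu>] assms that by linarith
  from this[of \<delta>] this[of \<beta>] have "threshold_fun \<mu> \<sigma> \<delta> \<beta> L lam 0 = L / \<delta> * (- b2) + lam * d2 - 1"
    unfolding threshold_fun_def Let_def b2_d2_def[symmetric] using assms by simp
  moreover have "critical_multiplier \<mu> \<sigma> \<delta> \<beta> L = (1 + b2 * (L / \<delta>)) / d2"
    unfolding critical_multiplier_def b2_d2_def by simp
  ultimately show ?thesis using neg by (simp add: neg_less_divide_eq mult.commute) linarith
qed

lemma threshold_fun_0_limit_neg: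
  assumes "\<sigma> > 0" "\<delta> > 0" "\<beta> > 0" "L > 0"
  shows "\<exists>b>0. threshold_fun \<mu> \<sigma> \<delta> \<beta> L 0 b < 0"
proof -
  define a1 a2 b2 where "a1 = root_plus \<mu> \<sigma> \<delta>" "a2 = root_minus \<mu> \<sigma> \<delta>" "b2 = root_minus (\<mu> - L) \<sigma> \<delta>"
  note d = a1_a2_b2_def
  have s: "a1 > 0" "a2 < b2" "b2 < 0"
    using assms by (auto simp: d root_plus_pos root_minus_neg root_minus_antimono_drift)
  define v where "v = \<sigma>^2 / 2"
  have q: "v * a1^2 + \<mu> * a1 - \<delta> = 0" "v * a2^2 + \<mu> * a2 - \<delta> = 0" "v * b2^2 + (\<mu> - L) * b2 - \<delta> = 0"
    using assms root_quadratic unfolding d v_def by blast+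
  \<comment> \<open>Vieta's formulas for the roots \<open>a1\<close>, \<open>a2\<close> reduce the limit of the first term to \<open>1 - b2 / a2\<close>.\<close>
  have "(a1 - a2) * (v * a1 * a2 + \<delta>) = 0" using q(1,2) by algebra
  then have vieta: "\<delta> = - (v * a1 * a2)" using s by simp
  have "(a1 - a2) * (\<mu> + v * (a1 + a2)) = 0" using q(1,2) by algebra
  then have "\<mu> + v * (a1 + a2) = 0" using s by simp
  then have "L * (- b2) = v * ((a1 - b2) * (b2 - a2))"
    using q(3) vieta by algebra
  moreover have "L / \<delta> * ((- b2) * a1 / (a1 - b2)) = L * (- b2) * a1 / (\<delta> * (a1 - b2))" by simp
  ultimately have "L / \<delta> * ((- b2) * a1 / (a1 - b2)) = v * (b2 - a2) * a1 / \<delta>"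
    using s assms(2) by simp
  also have "\<dots> < 1"
  proof -
    have "v * a1 * b2 < 0" using s assms by (intro mult_pos_neg mult_pos_pos) (auto simp: v_def)
    then have "v * (b2 - a2) * a1 < \<delta>" unfolding vieta by (simp add: algebra_simps)
    then show ?thesis using assms(2) by simp
  qed
  finally have lim: "L / \<delta> * ((- b2) * a1 / (a1 - b2)) < 1" .
  have "((\<lambda>b. L / \<delta> * reward_term a1 a2 b2 b) \<longlongrightarrow> L / \<delta> * ((- b2) * a1 / (a1 - b2))) at_top"
    using s by (intro tendsto_intros reward_term_tendsto) auto
  then have "\<forall>\<^sub>F b in at_top. L / \<delta> * reward_term a1 a2 b2 b < 1"
    by (rule order_tendstoD(2)[OF _ lim])
  then have "\<forall>\<^sub>F b in at_top. L / \<delta> * reward_term a1 a2 b2 b < 1 \<and> b > 0"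
    using eventually_gt_at_top[of 0] by eventually_elim auto
  then obtain b where "L / \<delta> * reward_term a1 a2 b2 b < 1" "b > 0"
    using eventually_happens'[of "at_top :: real filter"] by fastforce
  then show ?thesis unfolding threshold_fun_eq d by auto
qed

lemma equilibrium_threshold_of_zero:
  assumes "\<sigma> > 0" "\<delta> > 0" "\<beta> > 0" "L > 0" "lam \<le> 0" "b > 0"
    and "threshold_fun \<mu> \<sigma> \<delta> \<beta> L lam b = 0"
  shows "equilibrium_threshold \<mu> \<sigma> \<delta> \<beta> L lam b"
proof -
  have anti: "threshold_fun \<mu> \<sigma> \<delta> \<beta> L lam s < threshold_fun \<mu> \<sigma> \<delta> \<beta> L lam r" if "0 \<le> r" "r < s" for r s
    using threshold_fun_strict_antimono[OF assms(1-5) that] .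
  have "0 < threshold_fun \<mu> \<sigma> \<delta> \<beta> L lam 0" using anti[of 0 b] assms(6,7) by simp
  then have crit: "lam < critical_multiplier \<mu> \<sigma> \<delta> \<beta> L"
    by (simp only: threshold_fun_at_0_pos_iff[OF assms(1-4)])
  have "b' = b" if "b' > 0" "threshold_fun \<mu> \<sigma> \<delta> \<beta> L lam b' = 0" for b'
  proof (rule ccontr)
    assume "b' \<noteq> b"
    then consider "b < b'" | "b' < b" by linarith
    then show False using anti[of b b'] anti[of b' b] that assms(6,7) by cases simp_all
  qed
  then have "\<forall>b'>0. threshold_fun \<mu> \<sigma> \<delta> \<beta> L lam b' = 0 \<longrightarrow> b' = b" by blast
  then show ?thesis unfolding equilibrium_threshold_def if_P[OF crit] using assms(6,7) by blast
qed

lemma equilibrium_threshold_multiplier_0: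
  assumes "\<sigma> > 0" "\<delta> > 0" "\<beta> > 0" "L > 0"
  obtains b0 where "b0 \<ge> 0" "equilibrium_threshold \<mu> \<sigma> \<delta> \<beta> L 0 b0" "threshold_fun \<mu> \<sigma> \<delta> \<beta> L 0 b0 \<le> 0"
proof (cases "0 < critical_multiplier \<mu> \<sigma> \<delta> \<beta> L")
  case True
  then have pos: "0 < threshold_fun \<mu> \<sigma> \<delta> \<beta> L 0 0" using threshold_fun_at_0_pos_iff[OF assms] by simp
  obtain B where B: "B > 0" "threshold_fun \<mu> \<sigma> \<delta> \<beta> L 0 B < 0" using threshold_fun_0_limit_neg[OF assms] by blast
  have "isCont (threshold_fun \<mu> \<sigma> \<delta> \<beta> L 0) b" for b
  proof -
    have "isCont (reward_term (root_plus \<mu> \<sigma> \<delta>) (root_minus \<mu> \<sigma> \<delta>) (root_minus (\<mu> - L) \<sigma> \<delta>)) b"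
      using assms by (intro reward_term_isCont root_plus_pos root_minus_neg root_minus_antimono_drift) auto
    then show ?thesis unfolding threshold_fun_eq[abs_def] mult_zero_left by (intro continuous_intros)
  qed
  then have "continuous_on {0..B} (threshold_fun \<mu> \<sigma> \<delta> \<beta> L 0)"
    by (intro continuous_at_imp_continuous_on) simp
  then obtain b where b: "0 \<le> b" "b \<le> B" "threshold_fun \<mu> \<sigma> \<delta> \<beta> L 0 b = 0"
    using IVT2'[of "threshold_fun \<mu> \<sigma> \<delta> \<beta> L 0" B 0 0] B pos by auto
  with pos have "b > 0" by (cases "b = 0") auto
  with b show ?thesis using equilibrium_threshold_of_zero[OF assms, of 0 b] that[of b] by simp
next
  case False
  then show ?thesis using that[of 0] threshold_fun_at_0_pos_iff[OF assms, of \<mu> 0]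
    by (auto simp: equilibrium_threshold_def)
qed

text \<open>The threshold equation is affine in the multiplier with a negative coefficient, so it can be solved
  for the multiplier. The solution is nonpositive because the equation with multiplier \<open>0\<close> has a
  negative left-hand side to the right of \<open>b0\<close>.\<close>

lemma equilibrium_threshold_above:
  assumes "\<sigma> > 0" "\<delta> > 0" "\<beta> > 0" "L > 0"
    and b: "b0 \<ge> 0" "threshold_fun \<mu> \<sigma> \<delta> \<beta> L 0 b0 \<le> 0" "b > b0"
  obtains lam where "lam \<le> 0" "equilibrium_threshold \<mu> \<sigma> \<delta> \<beta> L lam b"
proof -
  define C where "C = constraint_term (root_plus \<mu> \<sigma> \<beta>) (root_minus \<mu> \<sigma> \<beta>) (root_minus (\<mu> - L) \<sigma> \<beta>) b"
  have C: "C < 0" unfolding C_def using assms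
    by (intro constraint_term_neg root_plus_pos root_minus_neg root_minus_antimono_drift) auto
  define G where "G = threshold_fun \<mu> \<sigma> \<delta> \<beta> L 0 b"
  have "G < 0" unfolding G_def using threshold_fun_strict_antimono[OF assms(1-4), of 0 b0 b \<mu>] b by simp
  have "threshold_fun \<mu> \<sigma> \<delta> \<beta> L (- G / C) b = 0"
    unfolding G_def threshold_fun_eq C_def[symmetric] using C by simp
  moreover have "- G / C \<le> 0" using \<open>G < 0\<close> C by (simp add: divide_nonpos_neg zero_le_divide_iff)
  ultimately show ?thesis using that[of "- G / C"] equilibrium_threshold_of_zero[OF assms(1-4), of "- G
      / C" b] b by simp
qed

section \<open>Comparison of paths driven by the same noise\<close>

lemma set_lebesgue_integral_singleton_lborel: "(LBINT s:{a..a}. f s :: real) = 0" for a :: real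
proof -
  have "AE s in lborel. indicator {a..a} s *\<^sub>R f s = 0"
    using AE_lborel_singleton[of a] by eventually_elim simp
  then show ?thesis unfolding set_lebesgue_integral_def by (rule integral_eq_zero_AE)
qed

text \<open>No regularity of the common noise \<open>w\<close> is needed: on an excursion of \<open>p\<close> above \<open>q\<close> the noise
  cancels in \<open>p - q\<close>, and the drifts make this difference nonincreasing.\<close>

lemma path_comparison:
  fixes p q u v w :: "real \<Rightarrow> real"
  assumes cont: "continuous_on {0..} p" "continuous_on {0..} q"
    and int: "\<And>t. t \<ge> 0 \<Longrightarrow> set_integrable lborel {0..t} u" "\<And>t. t \<ge> 0 \<Longrightarrow> set_integrable lborel {0..t} v"
    and p: "\<And>t. t \<ge> 0 \<Longrightarrow> p t = x + (LBINT s:{0..t}. u s) + w t"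
    and q: "\<And>t. t \<ge> 0 \<Longrightarrow> q t = y + (LBINT s:{0..t}. v s) + w t"
    and "x \<le> y"
    and drift: "\<And>s. s \<ge> 0 \<Longrightarrow> q s < p s \<Longrightarrow> u s \<le> v s"
    and "t \<ge> 0"
  shows "p t \<le> q t"
proof (rule ccontr)
  assume "\<not> p t \<le> q t"
  \<comment> \<open>After the last time \<open>s0\<close> before \<open>t\<close> at which \<open>p \<le> q\<close>, the difference \<open>p - q\<close> cannot increase.\<close>
  define S where "S = {s\<in>{0..t}. p s \<le> q s}"
  have "p 0 - q 0 = x - y"
    using p[of 0] q[of 0] by (simp add: set_lebesgue_integral_singleton_lborel del: atLeastAtMost_singleton)
  then have "0 \<in> S" using \<open>t \<ge> 0\<close> \<open>x \<le> y\<close> by (simp add: S_def)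
  have "closed S" unfolding S_def
    using cont by (intro continuous_closed_preimage_constant continuous_on_closed_Collect_le)
      (auto intro: continuous_on_subset)
  moreover have bdd: "bdd_above S" unfolding S_def by (auto intro!: bdd_aboveI[of _ t])
  ultimately have s0: "Sup S \<in> S" using \<open>0 \<in> S\<close> by (intro closed_contains_Sup) auto
  define s0 where "s0 = Sup S"
  have s0': "0 \<le> s0" "s0 \<le> t" "p s0 \<le> q s0" using s0 by (auto simp: s0_def S_def)
  have after: "q s < p s" if "s \<in> {s0<..t}" for s
  proof (rule ccontr)
    assume "\<not> q s < p s"
    then have "s \<in> S" using that s0' by (auto simp: S_def)
    then have "s \<le> s0" unfolding s0_def by (rule cSup_upper[OF _ bdd])
    then show False using that by simp
  qed
  have split: "{0..t} = {0..s0} \<union> {s0<..t}" using s0' by auto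
  have i: "set_integrable lborel {s0<..t} u" "set_integrable lborel {s0<..t} v"
    using int[OF \<open>t \<ge> 0\<close>] s0' by (auto elim!: set_integrable_subset)
  have "(LBINT s:{0..t}. u s) = (LBINT s:{0..s0}. u s) + (LBINT s:{s0<..t}. u s)"
    unfolding split using i int[of s0] s0' by (intro set_integral_Un) auto
  moreover have "(LBINT s:{0..t}. v s) = (LBINT s:{0..s0}. v s) + (LBINT s:{s0<..t}. v s)"
    unfolding split using i int[of s0] s0' by (intro set_integral_Un) auto
  moreover have "(LBINT s:{s0<..t}. u s) \<le> (LBINT s:{s0<..t}. v s)"
    using i after drift s0' by (intro set_integral_mono) auto
  ultimately have "p t - q t \<le> p s0 - q s0"
    using p[OF \<open>t \<ge> 0\<close>] q[OF \<open>t \<ge> 0\<close>] p[of s0] q[of s0] s0' by simp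
  then show False using s0' \<open>\<not> p t \<le> q t\<close> by simp
qed

lemma threshold_drift_integrable:
  fixes p :: "real \<Rightarrow> real"
  assumes "continuous_on {0..} p" "r \<ge> 0"
  shows "set_integrable lborel {r..t} (\<lambda>s. \<mu> - L * indicator {b..} (p s) :: real)"
proof -
  have "continuous_on {r..t} p" using assms by (auto elim!: continuous_on_subset)
  then have "closed ({r..t} \<inter> p -` {b..})"
    by (rule continuous_closed_preimage) auto
  then have B: "{r..t} \<inter> p -` {b..} \<in> sets lborel" by simp
  have "emeasure lborel ({r..t} \<inter> p -` {b..}) \<le> emeasure lborel {r..t}"
    by (intro emeasure_mono) auto
  also have "\<dots> < \<infinity>" by (simp add: emeasure_lborel_Icc_eq)
  finally have "integrable lborel (indicator ({r..t} \<inter> p -` {b..}) :: real \<Rightarrow> real)"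
    using B by (intro integrable_real_indicator)
  then have "set_integrable lborel {r..t} (\<lambda>s. indicator {b..} (p s) :: real)"
    unfolding set_integrable_def
    by (rule back_subst[where P = "integrable lborel"]) (auto simp: indicator_def)
  then show ?thesis
    by (intro set_integral_diff set_integrable_mult_right) 
      (simp_all add: set_integrable_def emeasure_lborel_Icc_eq)
qed

lemma set_lebesgue_integral_const_Icc:
  "0 \<le> t \<Longrightarrow> (LBINT s:{0..t}. m) = m * t" for m t :: real
  by (simp add: set_lebesgue_integral_def mult.commute)

section \<open>The ruin time of a continuous path\<close>

lemma ruin_time_le: "0 \<le> s \<Longrightarrow> X s \<omega> \<le> 0 \<Longrightarrow> ruin_time X \<omega> \<le> ereal s"
  unfolding ruin_time_def by (intro INF_lower) auto

lemma ruin_time_ge: "(\<And>s. 0 \<le> s \<Longrightarrow> X s \<omega> \<le> 0 \<Longrightarrow> r \<le> ereal s) \<Longrightarrow> r \<le> ruin_time X \<omega>"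
  unfolding ruin_time_def by (intro INF_greatest) auto

lemma ruin_time_nonneg: "0 \<le> ruin_time X \<omega>"
  by (rule ruin_time_ge) simp

lemma ruin_time_mono:
  "(\<And>s. 0 \<le> s \<Longrightarrow> X s \<omega> \<le> Y s \<omega>) \<Longrightarrow> ruin_time X \<omega> \<le> ruin_time Y \<omega>"
  by (intro ruin_time_ge ruin_time_le) (auto intro: order_trans)

lemma ruin_time_attained:
  assumes "continuous_on {0..} (\<lambda>t. X t \<omega>)" "ruin_time X \<omega> \<noteq> \<infinity>"
  obtains s where "0 \<le> s" "ruin_time X \<omega> = ereal s" "X s \<omega> \<le> 0"
proof -
  define S where "S = {s. 0 \<le> s \<and> X s \<omega> \<le> 0}"
  have "S \<noteq> {}" using assms(2) unfolding ruin_time_def S_def[symmetric] by (auto simp: top_ereal_def)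
  have "closed ({0..} \<inter> (\<lambda>t. X t \<omega>) -` {..0})"
    using assms(1) by (intro continuous_closed_preimage) auto
  moreover have "{0..} \<inter> (\<lambda>t. X t \<omega>) -` {..0} = S" by (auto simp: S_def)
  ultimately have "closed S" by simp
  moreover have bdd: "bdd_below S" unfolding S_def by (auto intro!: bdd_belowI[of _ 0])
  ultimately have "Inf S \<in> S" using \<open>S \<noteq> {}\<close> by (intro closed_contains_Inf)
  then have s: "0 \<le> Inf S" "X (Inf S) \<omega> \<le> 0" by (auto simp: S_def)
  have "ruin_time X \<omega> = ereal (Inf S)"
  proof (rule antisym)
    show "ruin_time X \<omega> \<le> ereal (Inf S)" using s by (rule ruin_time_le)
    show "ereal (Inf S) \<le> ruin_time X \<omega>"
    proof (rule ruin_time_ge)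
      fix s assume "0 \<le> s" "X s \<omega> \<le> 0"
      then have "s \<in> S" by (simp add: S_def)
      then show "ereal (Inf S) \<le> ereal s" using cInf_lower[OF _ bdd] by simp
    qed
  qed
  with s that show ?thesis by blast
qed

lemma ruin_time_measurable:
  fixes X :: "real \<Rightarrow> 'a \<Rightarrow> real"
  assumes meas: "\<And>t. t \<ge> 0 \<Longrightarrow> X t \<in> borel_measurable M"
    and cont: "\<And>\<omega>. \<omega> \<in> space M \<Longrightarrow> continuous_on {0..} (\<lambda>t. X t \<omega>)"
  shows "ruin_time X \<in> borel_measurable M"
proof (rule borel_measurableI_le)
  fix y :: ereal
  show "{\<omega> \<in> space M. ruin_time X \<omega> \<le> y} \<in> sets M"
  proof (cases y)
    case PInf
    then show ?thesis by simp
  next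
    case MInf
    have "ruin_time X \<omega> \<noteq> - \<infinity>" for \<omega> using ruin_time_nonneg[of X \<omega>] by auto
    then show ?thesis using MInf by simp
  next
    case (real r)
    show ?thesis
    proof (cases "r < 0")
      case True
      then have "\<not> ruin_time X \<omega> \<le> y" for \<omega>
        using order_trans[OF ruin_time_nonneg[of X \<omega>], of y] real by auto
      then show ?thesis by simp
    next
      case False
      \<comment> \<open>The countably many points \<open>q n k\<close> are dense in \<open>[0, r]\<close> and contain approximations from the left.\<close>
      define q where "q = (\<lambda>(n::nat) (k::nat). min r (real k / real (Suc n)))"
      have q: "0 \<le> q n k" "q n k \<le> r" for n k using False by (auto simp: q_def)
      have "{\<omega> \<in> space M. ruin_time X \<omega> \<le> y} =
          (\<Inter>m. \<Union>n. \<Union>k. {\<omega> \<in> space M. X (q n k) \<omega> < 1 / real (Suc m)})" (is "?A = ?B")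
      proof (intro equalityI subsetI)
        fix \<omega> assume "\<omega> \<in> ?A"
        then have \<omega>: "\<omega> \<in> space M" "ruin_time X \<omega> \<le> ereal r" using real by auto
        obtain s where s: "0 \<le> s" "ruin_time X \<omega> = ereal s" "X s \<omega> \<le> 0"
          using ruin_time_attained[of X \<omega>, OF cont[OF \<omega>(1)]] \<omega>(2) by force
        have "s \<le> r" using s \<omega> by simp
        define k where "k = (\<lambda>n. nat \<lfloor>s * real (Suc n)\<rfloor>)"
        have k: "real (k n) / real (Suc n) \<le> s" "s - 1 / real (Suc n) \<le> real (k n) / real (Suc n)" for n
        proof -
          have "real (k n) = of_int \<lfloor>s * real (Suc n)\<rfloor>" using s(1) unfolding k_def by simp
          then have "real (k n) \<le> s * real (Suc n)" "s * real (Suc n) \<le> real (k n) + 1" by linarith+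
          then have "real (k n) / real (Suc n) \<le> s" "s \<le> (real (k n) + 1) / real (Suc n)"
            by (simp_all only: pos_divide_le_eq pos_le_divide_eq of_nat_0_less_iff zero_less_Suc)
          then show "real (k n) / real (Suc n) \<le> s" "s - 1 / real (Suc n) \<le> real (k n) / real (Suc n)"
            unfolding add_divide_distrib by linarith+
        qed
        have qk: "q n (k n) = real (k n) / real (Suc n)" for n
          unfolding q_def using k(1)[of n] \<open>s \<le> r\<close> by simp
        have low: "(\<lambda>n. s - 1 / real (Suc n)) \<longlonglongrightarrow> s"
          using tendsto_diff[OF tendsto_const LIMSEQ_Suc[OF lim_1_over_n], of s] by simp
        have qlim: "(\<lambda>n. q n (k n)) \<longlonglongrightarrow> s" unfolding qk
          by (rule tendsto_sandwich[OF _ _ low tendsto_const]) (simp_all only: k eventually_True)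
        have lim: "(\<lambda>n. X (q n (k n)) \<omega>) \<longlonglongrightarrow> X s \<omega>"
          by (rule continuous_on_tendsto_compose[OF cont[OF \<omega>(1)] qlim]) (use s(1) q(1) in simp_all)
        show "\<omega> \<in> ?B"
        proof
          fix m :: nat
          have "X s \<omega> < 1 / real (Suc m)" using s by (simp add: order_le_less_trans)
          then have "\<forall>\<^sub>F n in sequentially. X (q n (k n)) \<omega> < 1 / real (Suc m)"
            by (rule order_tendstoD(2)[OF lim])
          then obtain n where "X (q n (k n)) \<omega> < 1 / real (Suc m)"
            by (auto simp: eventually_sequentially)
          then show "\<omega> \<in> (\<Union>n. \<Union>k. {\<omega> \<in> space M. X (q n k) \<omega> < 1 / real (Suc m)})" using \<omega> by blast
        qed
      next
        fix \<omega> assume B: "\<omega> \<in> ?B"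
        then have \<omega>: "\<omega> \<in> space M" by blast
        show "\<omega> \<in> ?A"
        proof (rule ccontr)
          assume "\<omega> \<notin> ?A"
          then have late: "\<not> ruin_time X \<omega> \<le> ereal r" using \<omega> real by simp
          have pos: "0 < X s \<omega>" if "0 \<le> s" "s \<le> r" for s
          proof (rule ccontr)
            assume "\<not> 0 < X s \<omega>"
            then have "ruin_time X \<omega> \<le> ereal s" using that by (intro ruin_time_le) auto
            also have "\<dots> \<le> ereal r" using that by simp
            finally show False using late by simp
          qed
          have "continuous_on {0..r} (\<lambda>t. X t \<omega>)"
            using cont[OF \<omega>] by (rule continuous_on_subset) auto
          then obtain s where s: "s \<in> {0..r}" "\<And>t. t \<in> {0..r} \<Longrightarrow> X s \<omega> \<le> X t \<omega>"
            using continuous_attains_inf[of "{0..r}" "\<lambda>t. X t \<omega>"] False by auto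
          obtain m where m: "1 / real (Suc m) < X s \<omega>"
            using nat_approx_posE[OF pos[of s]] s(1) by auto
          from B obtain n k where "X (q n k) \<omega> < 1 / real (Suc m)" by blast
          then show False using s(2)[of "q n k"] q[of n k] m by simp
        qed
      qed
      also have "\<dots> \<in> sets M"
      proof -
        have [measurable]: "X (q n k) \<in> borel_measurable M" for n k using meas q by simp
        show ?thesis by measurable
      qed
      finally show ?thesis .
    qed
  qed
qed

lemma discount_antimono:
  assumes "\<beta> > 0" "0 \<le> s" "s \<le> t"
  shows "discount \<beta> t \<le> discount \<beta> s"
proof (cases "t = \<infinity>")
  case True
  then show ?thesis by (simp add: discount_def)
next
  case False
  then have "s \<noteq> \<infinity>" "real_of_ereal s \<le> real_of_ereal t"
    using assms by (auto intro: real_of_ereal_positive_mono)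
  then show ?thesis using False assms by (simp add: discount_def)
qed

lemma discount_ereal [simp]: "discount \<beta> (ereal s) = exp (- \<beta> * s)"
  by (simp add: discount_def)

lemma discount_nonneg [simp]: "0 \<le> discount \<beta> t"
  by (simp add: discount_def)

lemma discount_le_1: "\<beta> > 0 \<Longrightarrow> 0 \<le> t \<Longrightarrow> discount \<beta> t \<le> 1"
  using discount_antimono[of \<beta> 0 t] by (simp add: discount_def)

lemma discount_measurable [measurable]: "discount \<beta> \<in> borel_measurable borel"
  unfolding discount_def by measurable

section \<open>Observing the ruin on a time grid\<close>

text \<open>The event that \<open>k * h\<close> is the first point of the time grid \<open>0, h, 2 * h, \<dots>\<close> at which the process is
  at most \<open>a\<close>.\<close>

definition grid_hit :: "'a measure \<Rightarrow> real \<Rightarrow> real \<Rightarrow> (real \<Rightarrow> 'a \<Rightarrow> real) \<Rightarrow> nat \<Rightarrow> 'a set" where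
  "grid_hit M h a X k = {\<omega> \<in> space M. X (real k * h) \<omega> \<le> a \<and> (\<forall>j<k. a < X (real j * h) \<omega>)}"

lemma disjoint_family_grid_hit: "disjoint_family (grid_hit M h a X)"
  unfolding disjoint_family_on_def grid_hit_def
  by (auto simp: disjoint_iff) (metis linorder_neqE_nat not_less)

lemma grid_hit_sets:
  assumes "space N = space M" "h > 0" "\<And>j. j \<le> k \<Longrightarrow> X (real j * h) \<in> borel_measurable N"
  shows "grid_hit M h a X k \<in> sets N"
proof -
  have [measurable]: "X (real j * h) \<in> borel_measurable N" if "j \<le> k" for j using assms(3) that .
  have "grid_hit M h a X k = {\<omega> \<in> space N. X (real k * h) \<omega> \<le> a} \<inter>
      {\<omega> \<in> space N. \<forall>j\<in>{..<k}. a < X (real j * h) \<omega>}"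
    unfolding grid_hit_def assms(1) by auto
  also have "\<dots> \<in> sets N"
    by (intro sets.Int sets.sets_Collect_finite_All)
        (auto intro!: borel_measurable_less borel_measurable_le assms(3)) 
  finally show ?thesis .
qed

text \<open>The level \<open>a > 0\<close> makes the grid notice the ruin: a path that is at most \<open>0\<close> at the ruin time stays
  below \<open>a\<close> for a while, so on a fine grid the first time at or below \<open>a\<close> is at most one mesh width
  after the ruin time.\<close>

lemma nn_integral_discount_ruin_le:
  fixes X :: "real \<Rightarrow> 'a \<Rightarrow> real"
  assumes "\<beta> > 0" "a > 0"
    and meas: "\<And>t. t \<ge> 0 \<Longrightarrow> X t \<in> borel_measurable M"
    and cont: "\<And>\<omega>. \<omega> \<in> space M \<Longrightarrow> continuous_on {0..} (\<lambda>t. X t \<omega>)"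
    and bound: "\<forall>\<^sub>F n in sequentially.
      (\<Sum>k. ennreal (exp (- \<beta> * (real k * (1 / real (Suc n))))) * emeasure M (grid_hit M (1 / real (Suc
          n)) a X k)) \<le> C"
  shows "(\<integral>\<^sup>+\<omega>. ennreal (discount \<beta> (ruin_time X \<omega>)) \<partial>M) \<le> C"
proof -
  define h where "h = (\<lambda>n. 1 / real (Suc n))"
  have h: "h n > 0" for n by (simp add: h_def)
  define H where "H = (\<lambda>n. grid_hit M (h n) a X)"
  have H[measurable]: "H n k \<in> sets M" for n k
    unfolding H_def using h[of n] meas by (intro grid_hit_sets) auto
  define S where "S = (\<lambda>n \<omega>. \<Sum>k. ennreal (exp (- \<beta> * (real k * h n))) * indicator (H n k) \<omega>)"
  have [measurable]: "S n \<in> borel_measurable M" for n unfolding S_def by measurable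
  have intS: "(\<integral>\<^sup>+\<omega>. S n \<omega> \<partial>M) = (\<Sum>k. ennreal (exp (- \<beta> * (real k * h n))) * emeasure M (H n k))" for n
    unfolding S_def by (subst nn_integral_suminf) (auto simp: nn_integral_cmult_indicator)
  have le: "ennreal (discount \<beta> (ruin_time X \<omega>)) \<le> liminf (\<lambda>n. S n \<omega>)" if \<omega>: "\<omega> \<in> space M" for \<omega>
  proof (cases "ruin_time X \<omega> = \<infinity>")
    case True
    then show ?thesis by (simp add: discount_def)
  next
    case False
    obtain s where s: "0 \<le> s" "ruin_time X \<omega> = ereal s" "X s \<omega> \<le> 0"
      using ruin_time_attained[of X \<omega>, OF cont[OF \<omega>] False] .
    define k where "k = (\<lambda>n. nat \<lceil>s * real (Suc n)\<rceil>)"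
    have k: "s \<le> real (k n) * h n" "real (k n) * h n \<le> s + h n" for n
    proof -
      have "0 \<le> s * real (Suc n)" using s by simp
      then have "real (k n) = of_int \<lceil>s * real (Suc n)\<rceil>" unfolding k_def by linarith
      then have "s * real (Suc n) \<le> real (k n)" "real (k n) \<le> s * real (Suc n) + 1" by linarith+
      then have "s \<le> real (k n) / real (Suc n)" "(real (k n) - 1) / real (Suc n) \<le> s"
        by (simp_all only: pos_divide_le_eq pos_le_divide_eq of_nat_0_less_iff zero_less_Suc diff_le_eq)
      then show "s \<le> real (k n) * h n" "real (k n) * h n \<le> s + h n"
        unfolding h_def diff_divide_distrib by simp_all
    qed
    have up: "(\<lambda>n. s + h n) \<longlonglongrightarrow> s" unfolding h_def
      using tendsto_add[OF tendsto_const LIMSEQ_Suc[OF lim_1_over_n], of s] by simp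
    have kh: "(\<lambda>n. real (k n) * h n) \<longlonglongrightarrow> s"
      by (rule tendsto_sandwich[OF _ _ tendsto_const up]) (simp_all only: k eventually_True)
    have "(\<lambda>n. X (real (k n) * h n) \<omega>) \<longlonglongrightarrow> X s \<omega>"
      by (rule continuous_on_tendsto_compose[OF cont[OF \<omega>] kh])
        (use s(1) order_trans[OF s(1) k(1)] in simp_all)
    then have "\<forall>\<^sub>F n in sequentially. X (real (k n) * h n) \<omega> < a"
      by (rule order_tendstoD) (use s \<open>a > 0\<close> in simp)
    then have ev: "\<forall>\<^sub>F n in sequentially. ennreal (exp (- \<beta> * (real (k n) * h n))) \<le> S n \<omega>"
    proof eventually_elim
      case (elim n)
      define j where "j = (LEAST j. X (real j * h n) \<omega> \<le> a)"
      have j: "X (real j * h n) \<omega> \<le> a" unfolding j_def by (rule LeastI[of _ "k n"]) (use elim in simp)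
      have "j \<le> k n" unfolding j_def by (rule Least_le) (use elim in simp)
      have "a < X (real i * h n) \<omega>" if "i < j" for i
        using not_less_Least[of i] that unfolding j_def by fastforce
      then have "\<omega> \<in> H n j" unfolding H_def grid_hit_def using \<omega> j by simp
      then have "S n \<omega> = ennreal (exp (- \<beta> * (real j * h n)))"
        unfolding S_def H_def by (intro suminf_cmult_indicator disjoint_family_grid_hit)
      moreover have "real j * h n \<le> real (k n) * h n" using \<open>j \<le> k n\<close> h[of n] by simp
      ultimately show ?case using \<open>\<beta> > 0\<close> by (simp add: ennreal_leI)
    qed
    have "(\<lambda>n. ennreal (exp (- \<beta> * (real (k n) * h n)))) \<longlonglongrightarrow> ennreal (exp (- \<beta> * s))"
      by (intro tendsto_ennrealI tendsto_intros kh)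
    then have "liminf (\<lambda>n. ennreal (exp (- \<beta> * (real (k n) * h n)))) = ennreal (exp (- \<beta> * s))"
      by (intro lim_imp_Liminf) auto
    moreover have "liminf (\<lambda>n. ennreal (exp (- \<beta> * (real (k n) * h n)))) \<le> liminf (\<lambda>n. S n \<omega>)"
      by (rule Liminf_mono[OF ev])
    ultimately show ?thesis using s(2) by simp
  qed
  have "(\<integral>\<^sup>+\<omega>. ennreal (discount \<beta> (ruin_time X \<omega>)) \<partial>M) \<le> (\<integral>\<^sup>+\<omega>. liminf (\<lambda>n. S n \<omega>) \<partial>M)"
    by (intro nn_integral_mono le)
  also have "\<dots> \<le> liminf (\<lambda>n. \<integral>\<^sup>+\<omega>. S n \<omega> \<partial>M)"
    by (intro nn_integral_liminf) auto
  also have "\<dots> \<le> limsup (\<lambda>n. \<integral>\<^sup>+\<omega>. S n \<omega> \<partial>M)"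
    by (intro Liminf_le_Limsup) auto
  also have "\<dots> \<le> C"
    by (rule Limsup_bounded) (use bound in \<open>simp add: intS H_def h_def\<close>)
  finally show ?thesis .
qed

section \<open>Exponential moments of Gaussian increments\<close>

lemma nn_integral_exp_normal:
  assumes "0 < s"
  shows "(\<integral>\<^sup>+y. ennreal (normal_density 0 s y) * ennreal (exp (a + r * y)) \<partial>lborel)
      = ennreal (exp (a + r\<^sup>2 * s\<^sup>2 / 2))"
proof -
  have "normal_density 0 s y * exp (a + r * y) = exp (a + r\<^sup>2 * s\<^sup>2 / 2) * normal_density (r * s\<^sup>2) s y" for y
  proof -
    have "- (y\<^sup>2) / (2 * s\<^sup>2) + (a + r * y) = (a + r\<^sup>2 * s\<^sup>2 / 2) + - ((y - r * s\<^sup>2)\<^sup>2) / (2 * s\<^sup>2)"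
      using assms by (simp add: field_simps power2_eq_square)
    then have "exp (- (y\<^sup>2) / (2 * s\<^sup>2)) * exp (a + r * y)
        = exp (a + r\<^sup>2 * s\<^sup>2 / 2) * exp (- ((y - r * s\<^sup>2)\<^sup>2) / (2 * s\<^sup>2))"
      unfolding exp_add[symmetric] by simp
    then show ?thesis unfolding normal_density_def by simp
  qed
  then have "(\<integral>\<^sup>+y. ennreal (normal_density 0 s y) * ennreal (exp (a + r * y)) \<partial>lborel)
      = (\<integral>\<^sup>+y. ennreal (exp (a + r\<^sup>2 * s\<^sup>2 / 2)) * ennreal (normal_density (r * s\<^sup>2) s y) \<partial>lborel)"
    by (simp add: ennreal_mult[symmetric])
  also have "\<dots> = ennreal (exp (a + r\<^sup>2 * s\<^sup>2 / 2)) * (\<integral>\<^sup>+y. ennreal (normal_density (r * s\<^sup>2) s y) \<partial>lborel)"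
    by (intro nn_integral_cmult) auto
  also have "(\<integral>\<^sup>+y. ennreal (normal_density (r * s\<^sup>2) s y) \<partial>lborel) = 1"
    using assms by (subst nn_integral_eq_integral) auto
  finally show ?thesis by simp
qed

text \<open>The Laplace exponent of Brownian motion with drift: \<open>exp (r * (\<mu> * h + \<sigma> * W h))\<close> has mean
  \<open>exp (exponent \<mu> \<sigma> r * h)\<close>. Its roots at level \<open>k\<close> are \<open>root_plus \<mu> \<sigma> k\<close> and \<open>root_minus \<mu> \<sigma> k\<close>.\<close>

definition exponent :: "real \<Rightarrow> real \<Rightarrow> real \<Rightarrow> real" where
  "exponent \<mu> \<sigma> r = \<mu> * r + \<sigma>\<^sup>2 * r\<^sup>2 / 2"

lemma nn_integral_exp_step:
  assumes "0 < h"
  shows "(\<integral>\<^sup>+y. ennreal (normal_density 0 (sqrt h) y) * ennreal (exp (r * (\<mu> * h + \<sigma> * y))) \<partial>lborel)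
    = ennreal (exp (exponent \<mu> \<sigma> r * h))"
  using nn_integral_exp_normal[of "sqrt h" "r * \<mu> * h" "r * \<sigma>"] assms
  by (simp add: exponent_def algebra_simps power_mult_distrib)

text \<open>Exponential moments of steps that are at least \<open>- \<kappa>\<close>. The loss by truncation is controlled by an
  exponential Chebyshev inequality with an auxiliary parameter \<open>K\<close>.\<close>

lemma nn_integral_exp_truncated_step:
  assumes "0 < h" "0 \<le> K"
    and gap: "exp (q * h) + exp (- K * \<kappa> + exponent \<mu> \<sigma> (r - K) * h) \<le> exp (exponent \<mu> \<sigma> r * h)"
  shows "ennreal (exp (q * h)) \<le> (\<integral>\<^sup>+y. ennreal (normal_density 0 (sqrt h) y) *
     (ennreal (exp (r * (\<mu> * h + \<sigma> * y))) * indicator {- \<kappa>..} (\<mu> * h + \<sigma> * y)) \<partial>lborel)"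
proof -
  let ?n = "\<lambda>y. ennreal (normal_density 0 (sqrt h) y)" and ?d = "\<lambda>y. \<mu> * h + \<sigma> * y"
  let ?I = "\<integral>\<^sup>+y. ?n y * (ennreal (exp (r * ?d y)) * indicator {- \<kappa>..} (?d y)) \<partial>lborel"
  have "ennreal (exp (q * h)) + ennreal (exp (- K * \<kappa>) * exp (exponent \<mu> \<sigma> (r - K) * h))
      \<le> ennreal (exp (exponent \<mu> \<sigma> r * h))"
    using gap unfolding exp_add by (simp add: ennreal_plus[symmetric] ennreal_leI del: ennreal_plus)
  also have "\<dots> = (\<integral>\<^sup>+y. ?n y * ennreal (exp (r * ?d y)) \<partial>lborel)"
    by (rule nn_integral_exp_step[OF \<open>0 < h\<close>, symmetric])
  also have "\<dots> \<le> (\<integral>\<^sup>+y. ?n y * (ennreal (exp (r * ?d y)) * indicator {- \<kappa>..} (?d y))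
      + ennreal (exp (- K * \<kappa>)) * (?n y * ennreal (exp ((r - K) * ?d y))) \<partial>lborel)"
  proof (rule nn_integral_mono)
    fix y
    have "ennreal (exp (r * ?d y)) \<le> ennreal (exp (r * ?d y)) * indicator {- \<kappa>..} (?d y)
      + ennreal (exp (- K * \<kappa>) * exp ((r - K) * ?d y))"
    proof (cases "- \<kappa> \<le> ?d y")
      case False
      then have "0 \<le> K * (- \<kappa> - ?d y)" using \<open>0 \<le> K\<close> by (intro mult_nonneg_nonneg) auto
      then have "r * ?d y \<le> - K * \<kappa> + (r - K) * ?d y" by (simp add: algebra_simps)
      then have "exp (r * ?d y) \<le> exp (- K * \<kappa>) * exp ((r - K) * ?d y)"
        unfolding exp_add[symmetric] by simp
      then show ?thesis using False by (simp add: ennreal_leI)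
    qed simp
    then have "?n y * ennreal (exp (r * ?d y)) \<le> ?n y * (ennreal (exp (r * ?d y)) * indicator {- \<kappa>..} (?d y)
      + ennreal (exp (- K * \<kappa>) * exp ((r - K) * ?d y)))"
      by (rule mult_left_mono) simp
    then show "?n y * ennreal (exp (r * ?d y)) \<le> ?n y * (ennreal (exp (r * ?d y)) * indicator {- \<kappa>..} (?d y))
      + ennreal (exp (- K * \<kappa>)) * (?n y * ennreal (exp ((r - K) * ?d y)))"
      by (simp add: distrib_left ennreal_mult mult_ac)
  qed
  also have "\<dots> = ?I + ennreal (exp (- K * \<kappa>)) * (\<integral>\<^sup>+y. ?n y * ennreal (exp ((r - K) * ?d y)) \<partial>lborel)"
    by (subst nn_integral_add) (auto intro!: nn_integral_cmult)
  also have "(\<integral>\<^sup>+y. ?n y * ennreal (exp ((r - K) * ?d y)) \<partial>lborel) = ennreal (exp (exponent \<mu> \<sigma> (r - K) * h))"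
    by (rule nn_integral_exp_step[OF \<open>0 < h\<close>])
  finally have "ennreal (exp (- K * \<kappa>) * exp (exponent \<mu> \<sigma> (r - K) * h)) + ennreal (exp (q * h))
      \<le> ennreal (exp (- K * \<kappa>) * exp (exponent \<mu> \<sigma> (r - K) * h)) + ?I"
    by (simp add: ennreal_mult add.commute)
  then show ?thesis by (subst (asm) ennreal_add_left_cancel_le) auto
qed

text \<open>The hypothesis of \<open>nn_integral_exp_truncated_step\<close> for mesh \<open>h = 1 / Suc n\<close>. The choice
  \<open>K = sqrt (Suc n)\<close> keeps \<open>exponent \<mu> \<sigma> (r - K) * h\<close> bounded, so that the truncation error is
  \<open>o(h)\<close>, while the gain \<open>exp (exponent \<mu> \<sigma> r * h) - exp (q * h)\<close> is of order \<open>h\<close>.\<close>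

lemma eventually_truncated_step_gap:
  assumes "0 < \<kappa>" "0 < q" "q < exponent \<mu> \<sigma> r"
  shows "\<forall>\<^sub>F n in sequentially. exp (q * (1 / real (Suc n)))
     + exp (- sqrt (real (Suc n)) * \<kappa> + exponent \<mu> \<sigma> (r - sqrt (real (Suc n))) * (1 / real (Suc n)))
     \<le> exp (exponent \<mu> \<sigma> r * (1 / real (Suc n)))"
proof -
  define p where "p = exponent \<mu> \<sigma> r"
  have "(\<lambda>n::nat. (real n + 1) * exp (- sqrt (real n + 1) * \<kappa> + (\<mu> * (r - sqrt (real n + 1))
     + \<sigma>\<^sup>2 * (r - sqrt (real n + 1))\<^sup>2 / 2) * (1 / (real n + 1)))) \<longlonglongrightarrow> 0"
    using \<open>0 < \<kappa>\<close> by real_asymp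
  then have "\<forall>\<^sub>F n in sequentially. (real n + 1) * exp (- sqrt (real n + 1) * \<kappa> + (\<mu> * (r - sqrt (real n + 1))
     + \<sigma>\<^sup>2 * (r - sqrt (real n + 1))\<^sup>2 / 2) * (1 / (real n + 1))) < p - q"
    using assms(3) by (intro order_tendstoD(2)[where y = "0::real"]) (auto simp: p_def)
  then show ?thesis
  proof eventually_elim
    case (elim n)
    define h where "h = 1 / real (Suc n)"
    have h: "h > 0" "real n + 1 = 1 / h" by (auto simp: h_def)
    define z where "z = exp (- sqrt (real (Suc n)) * \<kappa> + exponent \<mu> \<sigma> (r - sqrt (real (Suc n))) * h)"
    have "(1 / h) * z < p - q"
      using elim unfolding z_def exponent_def h(2)[symmetric] by (simp add: h_def add.commute)
    then have z: "z < (p - q) * h" using h by (simp add: field_simps)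
    have e: "(p - q) * h \<le> exp ((p - q) * h) - 1"
      using exp_ge_add_one_self[of "(p - q) * h"] by linarith
    have "1 \<le> exp (q * h)" "0 \<le> (p - q) * h" using assms h by (simp_all add: p_def)
    then have "1 * ((p - q) * h) \<le> exp (q * h) * (exp ((p - q) * h) - 1)"
      using e by (intro mult_mono) simp_all
    also have "\<dots> = exp (q * h + (p - q) * h) - exp (q * h)"
      unfolding exp_add by (simp add: algebra_simps)
    also have "q * h + (p - q) * h = p * h" by (simp add: algebra_simps)
    finally have "exp (q * h) + (p - q) * h \<le> exp (p * h)" by simp
    then show ?case using z unfolding z_def h_def p_def by linarith
  qed
qed

section \<open>Brownian increments and the past\<close>

text \<open>A fixed filtered probability space with a Brownian motion.\<close>

locale brownian =
  fixes M :: "'a measure" and F :: "real \<Rightarrow> 'a measure" and W :: "real \<Rightarrow> 'a \<Rightarrow> real"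
  assumes brownian_motion: "brownian_motion M F W"
begin

sublocale prob_space M
  using brownian_motion unfolding brownian_motion_def filtered_prob_space_def by blast

lemma space_F [simp]: "space (F t) = space M"
  using brownian_motion
  unfolding brownian_motion_def filtered_prob_space_def subalgebra_def by blast

lemma sets_F_subset: "sets (F t) \<subseteq> sets M"
  using brownian_motion
  unfolding brownian_motion_def filtered_prob_space_def subalgebra_def by blast

lemma sets_F_mono: "s \<le> t \<Longrightarrow> sets (F s) \<subseteq> sets (F t)"
  using brownian_motion filtration.sets_F_mono
  unfolding brownian_motion_def filtered_prob_space_def by blast

lemma measurable_F_mono: "f \<in> measurable (F s) N \<Longrightarrow> s \<le> t \<Longrightarrow> f \<in> measurable (F t) N"
  using sets_F_mono[of s t] unfolding measurable_def by auto

lemma measurable_F_M: "f \<in> measurable (F s) N \<Longrightarrow> f \<in> measurable M N"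
  using sets_F_subset[of s] unfolding measurable_def by auto

lemma increment_distributed:
  "0 \<le> s \<Longrightarrow> s < t \<Longrightarrow>
     distributed M lborel (\<lambda>\<omega>. W t \<omega> - W s \<omega>) (\<lambda>y. ennreal (normal_density 0 (sqrt (t - s)) y))"
  using brownian_motion unfolding brownian_motion_def by blast

lemma increment_indep:
  "0 \<le> s \<Longrightarrow> s < t \<Longrightarrow>
     indep_set (sets (F s)) {(\<lambda>\<omega>. W t \<omega> - W s \<omega>) -` A \<inter> space M | A. A \<in> sets borel}"
  using brownian_motion unfolding brownian_motion_def by blast

lemma nn_integral_indep_increment:
  fixes Z :: "'a \<Rightarrow> ennreal" and f :: "real \<Rightarrow> ennreal"
  assumes st: "0 \<le> s" "s < t"
    and Z: "Z \<in> borel_measurable (F s)" and f[measurable]: "f \<in> borel_measurable borel"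
  shows "(\<integral>\<^sup>+\<omega>. Z \<omega> * f (W t \<omega> - W s \<omega>) \<partial>M) =
    (\<integral>\<^sup>+\<omega>. Z \<omega> \<partial>M) * (\<integral>\<^sup>+y. ennreal (normal_density 0 (sqrt (t - s)) y) * f y \<partial>lborel)"
proof -
  let ?D = "\<lambda>\<omega>. W t \<omega> - W s \<omega>"
  have D[measurable]: "?D \<in> borel_measurable M"
    using distributed_measurable[OF increment_distributed[OF st]] by simp
  have ZM[measurable]: "Z \<in> borel_measurable M" using Z by (rule measurable_F_M)
  have "indep_var borel Z borel (\<lambda>\<omega>. f (?D \<omega>))"
    unfolding indep_var_eq
  proof (intro conjI)
    have 1: "sigma_sets (space M) {Z -` A \<inter> space M |A. A \<in> sets borel} \<subseteq> sets (F s)"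
    proof -
      have "{Z -` A \<inter> space M |A. A \<in> sets borel} \<subseteq> sets (F s)"
        using measurable_sets[OF Z] by auto
      then show ?thesis using sets.sigma_sets_subset[of _ "F s"] by simp
    qed
    have "{(\<lambda>\<omega>. f (?D \<omega>)) -` A \<inter> space M |A. A \<in> sets borel} \<subseteq>
        {?D -` A \<inter> space M | A. A \<in> sets borel}" (is "?G \<subseteq> ?H")
    proof safe
      fix A :: "ennreal set" assume "A \<in> sets borel"
      then have "f -` A \<in> sets borel" using measurable_sets[OF f] by simp
      moreover have "(\<lambda>\<omega>. f (?D \<omega>)) -` A \<inter> space M = ?D -` (f -` A) \<inter> space M" by auto
      ultimately show "\<exists>B. (\<lambda>\<omega>. f (?D \<omega>)) -` A \<inter> space M = ?D -` B \<inter> space M \<and> B \<in> sets borel"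
        by blast
    qed
    moreover have H: "?H = sets (vimage_algebra (space M) ?D borel)"
      by (rule sets_vimage_algebra2[symmetric]) simp
    ultimately have 2: "sigma_sets (space M) ?G \<subseteq> ?H"
      using sets.sigma_sets_subset[of ?G "vimage_algebra (space M) ?D borel"] by simp
    show "indep_set (sigma_sets (space M) {Z -` A \<inter> space M |A. A \<in> sets borel}) (sigma_sets (space M) ?G)"
      using increment_indep[OF st] 1 2 unfolding indep_sets2_eq
      by (intro conjI ballI; meson subset_iff subset_trans)
  qed simp_all
  moreover have "case_bool borel borel = (\<lambda>_. borel :: ennreal measure)"
    by (rule ext) (simp split: bool.split)
  ultimately have "indep_vars (\<lambda>_. borel) (case_bool Z (\<lambda>\<omega>. f (?D \<omega>))) UNIV"
    unfolding indep_var_def by simp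
  from indep_vars_nn_integral[OF _ this]
  have "(\<integral>\<^sup>+\<omega>. Z \<omega> * f (?D \<omega>) \<partial>M) = (\<integral>\<^sup>+\<omega>. Z \<omega> \<partial>M) * (\<integral>\<^sup>+\<omega>. f (?D \<omega>) \<partial>M)"
    by (simp add: UNIV_bool mult.commute)
  also have "(\<integral>\<^sup>+\<omega>. f (?D \<omega>) \<partial>M) = (\<integral>\<^sup>+y. ennreal (normal_density 0 (sqrt (t - s)) y) * f y \<partial>lborel)"
    using distributed_nn_integral[OF increment_distributed[OF st], of f] by simp
  finally show ?thesis .
qed

section \<open>Lower bound after the entrance near ruin\<close>

lemma continuous_adaptedD:
  assumes "continuous_adapted M F X"
  shows "t \<ge> 0 \<Longrightarrow> X t \<in> borel_measurable (F t)" "t \<ge> 0 \<Longrightarrow> X t \<in> borel_measurable M"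
    "\<omega> \<in> space M \<Longrightarrow> continuous_on {0..} (\<lambda>t. X t \<omega>)"
  using assms measurable_F_M unfolding continuous_adapted_def by blast+

text \<open>Before ruin, the process \<open>exp (c * (X + \<kappa>) - \<beta> * t)\<close> increases in mean over one grid step, where
  its value is replaced by \<open>1\<close> if the step ends at or below \<open>0\<close>. This cap is harmless: a step of size
  at least \<open>- \<kappa>\<close> starting above \<open>0\<close> ends above \<open>- \<kappa>\<close>, where the exponential is at most \<open>1\<close>. Larger downward
  steps are discarded; by \<open>trunc\<close> the remaining ones still suffice.\<close>

lemma submartingale_step:
  assumes "h > 0" "t \<ge> 0" "c < 0"
    and Xt: "X t \<in> borel_measurable (F t)"
    and step: "AE \<omega> in M. X (t + h) \<omega> \<le> X t \<omega> + (\<mu> * h + \<sigma> * (W (t + h) \<omega> - W t \<omega>))"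
    and B: "B \<in> sets (F t)" "\<And>\<omega>. \<omega> \<in> B \<Longrightarrow> 0 < X t \<omega>"
    and trunc: "ennreal (exp (\<beta> * h)) \<le> (\<integral>\<^sup>+y. ennreal (normal_density 0 (sqrt h) y) *
     (ennreal (exp (c * (\<mu> * h + \<sigma> * y))) * indicator {- \<kappa>..} (\<mu> * h + \<sigma> * y)) \<partial>lborel)"
  shows "(\<integral>\<^sup>+\<omega>. indicator B \<omega> * ennreal (exp (c * (X t \<omega> + \<kappa>))) \<partial>M) \<le>
    ennreal (exp (- \<beta> * h)) *
    (\<integral>\<^sup>+\<omega>. indicator B \<omega> * (if 0 < X (t + h) \<omega> then ennreal (exp (c * (X (t + h) \<omega> + \<kappa>))) else 1) \<partial>M)"
    (is "?I \<le> _ * ?J")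
proof -
  define Z where "Z = (\<lambda>\<omega>. indicator B \<omega> * ennreal (exp (c * (X t \<omega> + \<kappa>))))"
  define f where "f = (\<lambda>y. ennreal (exp (c * (\<mu> * h + \<sigma> * y))) * indicator {- \<kappa>..} (\<mu> * h + \<sigma> * y))"
  have Z: "Z \<in> borel_measurable (F t)" unfolding Z_def using Xt B(1) by measurable
  have "?I * ennreal (exp (\<beta> * h)) \<le> (\<integral>\<^sup>+\<omega>. Z \<omega> \<partial>M) *
     (\<integral>\<^sup>+y. ennreal (normal_density 0 (sqrt (t + h - t)) y) * f y \<partial>lborel)"
    using trunc unfolding Z_def f_def by (simp add: mult_left_mono)
  also have "\<dots> = (\<integral>\<^sup>+\<omega>. Z \<omega> * f (W (t + h) \<omega> - W t \<omega>) \<partial>M)"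
    using \<open>h > 0\<close> \<open>t \<ge> 0\<close> Z by (intro nn_integral_indep_increment[symmetric]) (auto simp: f_def)
  also have "\<dots> \<le> ?J"
  proof (rule nn_integral_mono_AE)
    show "AE \<omega> in M. Z \<omega> * f (W (t + h) \<omega> - W t \<omega>) \<le>
      indicator B \<omega> * (if 0 < X (t + h) \<omega> then ennreal (exp (c * (X (t + h) \<omega> + \<kappa>))) else 1)"
      using step
    proof eventually_elim
      case (elim \<omega>)
      define d where "d = \<mu> * h + \<sigma> * (W (t + h) \<omega> - W t \<omega>)"
      show ?case
      proof (cases "\<omega> \<in> B \<and> - \<kappa> \<le> d")
        case True
        have "Z \<omega> * f (W (t + h) \<omega> - W t \<omega>) = ennreal (exp (c * (X t \<omega> + \<kappa>)) * exp (c * d))"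
          using True by (simp add: Z_def f_def d_def[symmetric] ennreal_mult)
        also have "\<dots> = ennreal (exp (c * (X t \<omega> + d + \<kappa>)))"
          unfolding exp_add[symmetric] by (simp add: algebra_simps)
        also have "\<dots> \<le> (if 0 < X (t + h) \<omega> then ennreal (exp (c * (X (t + h) \<omega> + \<kappa>))) else 1)"
        proof (cases "0 < X (t + h) \<omega>")
          case True
          have "c * (X t \<omega> + d + \<kappa>) \<le> c * (X (t + h) \<omega> + \<kappa>)"
            using elim \<open>c < 0\<close> by (intro mult_left_mono_neg) (auto simp: d_def)
          then show ?thesis using True by (simp add: ennreal_leI)
        next
          case False
          have "c * (X t \<omega> + d + \<kappa>) \<le> 0"
            using B(2)[of \<omega>] True \<open>c < 0\<close> by (intro mult_nonpos_nonneg) auto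
          then show ?thesis using False by simp
        qed
        finally show ?thesis using True by simp
      next
        case False
        then have "Z \<omega> * f (W (t + h) \<omega> - W t \<omega>) = 0"
          by (auto simp: Z_def f_def d_def[symmetric])
        then show ?thesis by (simp only: zero_le)
      qed
    qed
  qed
  finally have "ennreal (exp (- \<beta> * h)) * (?I * ennreal (exp (\<beta> * h))) \<le> ennreal (exp (- \<beta> * h)) * ?J"
    by (rule mult_left_mono) simp
  moreover have "ennreal (exp (- \<beta> * h)) * (?I * ennreal (exp (\<beta> * h))) = ?I"
  proof -
    have "ennreal (exp (- \<beta> * h)) * ennreal (exp (\<beta> * h)) = 1"
      by (simp add: ennreal_mult[symmetric] exp_add[symmetric])
    then have "?I * (ennreal (exp (- \<beta> * h)) * ennreal (exp (\<beta> * h))) = ?I" by simp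
    then show ?thesis by (simp only: mult_ac)
  qed
  ultimately show ?thesis by simp
qed

text \<open>If the process is at most \<open>\<eta>\<close> at a grid time, then the expected discount for the time until ruin is
  at least \<open>exp (c * (\<eta> + \<kappa>))\<close>, also when restricted to an event of the past.\<close>

lemma ruin_lower_bound:
  assumes pos: "h > 0" "\<beta> > 0" "c < 0" "\<kappa> \<ge> 0" "\<eta> \<ge> 0"
    and X: "continuous_adapted M F X"
    and step: "\<And>t. t \<ge> 0 \<Longrightarrow>
      AE \<omega> in M. X (t + h) \<omega> \<le> X t \<omega> + (\<mu> * h + \<sigma> * (W (t + h) \<omega> - W t \<omega>))"
    and trunc: "ennreal (exp (\<beta> * h)) \<le> (\<integral>\<^sup>+y. ennreal (normal_density 0 (sqrt h) y) *
     (ennreal (exp (c * (\<mu> * h + \<sigma> * y))) * indicator {- \<kappa>..} (\<mu> * h + \<sigma> * y)) \<partial>lborel)"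
    and A: "A \<in> sets (F (real k * h))" "AE \<omega> in M. \<omega> \<in> A \<longrightarrow> X (real k * h) \<omega> \<le> \<eta>"
  shows "ennreal (exp (- \<beta> * (real k * h)) * exp (c * (\<eta> + \<kappa>))) * emeasure M A
    \<le> (\<integral>\<^sup>+\<omega>. indicator A \<omega> * ennreal (discount \<beta> (ruin_time X \<omega>)) \<partial>M)"
proof -
  define t where "t = (\<lambda>n. real (k + n) * h)"
  have t: "0 \<le> t n" "t (Suc n) = t n + h" for n
    using pos by (auto simp: t_def algebra_simps)
  define B where "B = (\<lambda>n. {\<omega> \<in> A. \<forall>j\<in>{k..k+n}. 0 < X (real j * h) \<omega>})"
  define D where "D = (\<lambda>\<omega>. ennreal (discount \<beta> (ruin_time X \<omega>)))"
  define U where "U = (\<lambda>n \<omega>. indicator (B n) \<omega> * ennreal (exp (c * (X (t n) \<omega> + \<kappa>))))"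
  note XF = continuous_adaptedD(1)[OF X] and XM = continuous_adaptedD(2)[OF X]
  have AM[measurable]: "A \<in> sets M" using A(1) sets_F_subset by blast
  have t_mono: "real j * h \<le> t n" if "j \<le> k + n" for j n
    unfolding t_def using pos that by (intro mult_right_mono) simp_all
  have AF: "A \<in> sets (F (t n))" for n
    using A(1) sets_F_mono[OF t_mono[of k n]] by auto
  have BF: "B n \<in> sets (F (t n))" for n
  proof -
    have meas: "X (real j * h) \<in> borel_measurable (F (t n))" if "j \<le> k + n" for j
      by (rule measurable_F_mono[OF XF t_mono[OF that]]) (use pos in simp)
    have "{\<omega> \<in> space (F (t n)). 0 < X (real j * h) \<omega>} \<in> sets (F (t n))" if "j \<in> {k..k+n}" for j
      by (rule borel_measurable_less) (use that meas in auto)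
    then have "{\<omega> \<in> space (F (t n)). \<forall>j\<in>{k..k+n}. 0 < X (real j * h) \<omega>} \<in> sets (F (t n))"
      by (rule sets.sets_Collect_finite_All) simp_all
    then have "A \<inter> {\<omega> \<in> space (F (t n)). \<forall>j\<in>{k..k+n}. 0 < X (real j * h) \<omega>} \<in> sets (F (t n))"
      using AF by blast
    moreover have "A \<inter> {\<omega> \<in> space (F (t n)). \<forall>j\<in>{k..k+n}. 0 < X (real j * h) \<omega>} = B n"
      unfolding B_def using sets.sets_into_space[OF AF[of n]] by auto
    ultimately show ?thesis by simp
  qed
  have BM[measurable]: "B n \<in> sets M" for n using BF sets_F_subset by blast
  have BA: "B n \<subseteq> A" for n by (auto simp: B_def)
  have Bpos: "0 < X (t n) \<omega>" if "\<omega> \<in> B n" for n \<omega>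
  proof -
    have "\<forall>j\<in>{k..k+n}. 0 < X (real j * h) \<omega>" using that by (simp add: B_def)
    then show ?thesis unfolding t_def by (rule bspec) simp
  qed
  have BSuc: "B (Suc n) = {\<omega> \<in> B n. 0 < X (t (Suc n)) \<omega>}" for n
  proof -
    have "{k..k + Suc n} = insert (k + Suc n) {k..k+n}" by auto
    then show ?thesis unfolding B_def t_def by (auto simp del: of_nat_add)
  qed
  have Xt[measurable]: "X (t n) \<in> borel_measurable M" for n using XM t by simp
  have [measurable]: "ruin_time X \<in> borel_measurable M"
    using continuous_adaptedD[OF X] by (intro ruin_time_measurable) auto
  have D[measurable]: "D \<in> borel_measurable M" unfolding D_def by measurable
  have U[measurable]: "U n \<in> borel_measurable M" for n unfolding U_def by measurable
  have D_ge: "ennreal (exp (- \<beta> * t n)) \<le> D \<omega>" if "X (t n) \<omega> \<le> 0" for n \<omega>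
    using discount_antimono[OF pos(2) ruin_time_nonneg ruin_time_le[of "t n" X \<omega>, OF t(1) that]]
    unfolding D_def by (simp add: ennreal_leI)
  \<comment> \<open>The value after \<open>n\<close> steps: the exponential on paths not yet seen at or below \<open>0\<close>, and the true
    discount on the others. It is nondecreasing in \<open>n\<close>, and the first summand vanishes as \<open>n \<rightarrow> \<infinity>\<close>.\<close>
  define \<Phi> where "\<Phi> = (\<lambda>n. ennreal (exp (- \<beta> * t n)) * (\<integral>\<^sup>+\<omega>. U n \<omega> \<partial>M)
    + (\<integral>\<^sup>+\<omega>. indicator (A - B n) \<omega> * D \<omega> \<partial>M))"
  have "\<Phi> n \<le> \<Phi> (Suc n)" for n
  proof -
    let ?e = "ennreal (exp (- \<beta> * t (Suc n)))"
    have e: "ennreal (exp (- \<beta> * t n)) * ennreal (exp (- \<beta> * h)) = ?e"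
      unfolding t(2) by (simp add: ennreal_mult[symmetric] exp_add[symmetric] algebra_simps)
    have "(\<integral>\<^sup>+\<omega>. U n \<omega> \<partial>M) \<le> ennreal (exp (- \<beta> * h)) *
       (\<integral>\<^sup>+\<omega>. indicator (B n) \<omega> * (if 0 < X (t n + h) \<omega> then ennreal (exp (c * (X (t n + h) \<omega> + \<kappa>)))
           else 1) \<partial>M)"
      unfolding U_def using pos t(1) XF BF Bpos step trunc by (intro submartingale_step) auto
    also have "(\<integral>\<^sup>+\<omega>. indicator (B n) \<omega> * (if 0 < X (t n + h) \<omega> then ennreal (exp (c * (X (t n + h) \<omega> +
        \<kappa>))) else 1) \<partial>M)
      = (\<integral>\<^sup>+\<omega>. U (Suc n) \<omega> + indicator (B n - B (Suc n)) \<omega> \<partial>M)"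
      by (rule nn_integral_cong) (auto simp: U_def BSuc t(2) indicator_def)
    also have "\<dots> = (\<integral>\<^sup>+\<omega>. U (Suc n) \<omega> \<partial>M) + (\<integral>\<^sup>+\<omega>. indicator (B n - B (Suc n)) \<omega> \<partial>M)"
      by (rule nn_integral_add) measurable
    finally have "ennreal (exp (- \<beta> * t n)) * (\<integral>\<^sup>+\<omega>. U n \<omega> \<partial>M) \<le>
        ennreal (exp (- \<beta> * t n)) * (ennreal (exp (- \<beta> * h)) *
          ((\<integral>\<^sup>+\<omega>. U (Suc n) \<omega> \<partial>M) + (\<integral>\<^sup>+\<omega>. indicator (B n - B (Suc n)) \<omega> \<partial>M)))"
      by (rule mult_left_mono) simp
    also have "\<dots> = ?e * (\<integral>\<^sup>+\<omega>. U (Suc n) \<omega> \<partial>M) + ?e * (\<integral>\<^sup>+\<omega>. indicator (B n - B (Suc n)) \<omega> \<partial>M)"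
      unfolding e[symmetric] by (simp add: distrib_left mult.assoc)
    also have "?e * (\<integral>\<^sup>+\<omega>. indicator (B n - B (Suc n)) \<omega> \<partial>M) = (\<integral>\<^sup>+\<omega>. ?e * indicator (B n - B (Suc n)) \<omega> \<partial>M)"
      by (rule nn_integral_cmult[symmetric]) measurable
    also have "\<dots> \<le> (\<integral>\<^sup>+\<omega>. indicator (B n - B (Suc n)) \<omega> * D \<omega> \<partial>M)"
    proof (rule nn_integral_mono)
      fix \<omega>
      show "?e * indicator (B n - B (Suc n)) \<omega> \<le> indicator (B n - B (Suc n)) \<omega> * D \<omega>"
        using D_ge[of "Suc n" \<omega>] by (auto simp: BSuc indicator_def)
    qed
    finally have "\<Phi> n \<le> ?e * (\<integral>\<^sup>+\<omega>. U (Suc n) \<omega> \<partial>M) +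
        ((\<integral>\<^sup>+\<omega>. indicator (B n - B (Suc n)) \<omega> * D \<omega> \<partial>M) + (\<integral>\<^sup>+\<omega>. indicator (A - B n) \<omega> * D \<omega> \<partial>M))"
      unfolding \<Phi>_def by (simp add: add.assoc[symmetric] add_mono)
    also have "(\<integral>\<^sup>+\<omega>. indicator (B n - B (Suc n)) \<omega> * D \<omega> \<partial>M) + (\<integral>\<^sup>+\<omega>. indicator (A - B n) \<omega> * D \<omega> \<partial>M)
      = (\<integral>\<^sup>+\<omega>. indicator (B n - B (Suc n)) \<omega> * D \<omega> + indicator (A - B n) \<omega> * D \<omega> \<partial>M)"
      by (rule nn_integral_add[symmetric]) measurable
    also have "\<dots> = (\<integral>\<^sup>+\<omega>. indicator (A - B (Suc n)) \<omega> * D \<omega> \<partial>M)"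
      using BA[of n] by (intro nn_integral_cong) (auto simp: BSuc indicator_def)
    finally show ?thesis unfolding \<Phi>_def .
  qed
  then have incr: "\<Phi> 0 \<le> \<Phi> n" for n by (induction n) (auto intro: order_trans)
  have base: "ennreal (exp (- \<beta> * (real k * h)) * exp (c * (\<eta> + \<kappa>))) * emeasure M A \<le> \<Phi> 0"
  proof -
    let ?e = "ennreal (exp (- \<beta> * t 0))" and ?g = "ennreal (exp (c * (\<eta> + \<kappa>)))"
    have "c * (\<eta> + \<kappa>) \<le> 0" using pos by (intro mult_nonpos_nonneg) auto
    then have g1: "?g \<le> 1" by simp
    have "ennreal (exp (- \<beta> * (real k * h)) * exp (c * (\<eta> + \<kappa>))) * emeasure M A
        = (\<integral>\<^sup>+\<omega>. ?e * ?g * indicator A \<omega> \<partial>M)"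
      by (simp add: nn_integral_cmult_indicator t_def ennreal_mult)
    also have "\<dots> \<le> (\<integral>\<^sup>+\<omega>. ?e * U 0 \<omega> + indicator (A - B 0) \<omega> * D \<omega> \<partial>M)"
    proof (rule nn_integral_mono_AE)
      show "AE \<omega> in M. ?e * ?g * indicator A \<omega> \<le> ?e * U 0 \<omega> + indicator (A - B 0) \<omega> * D \<omega>"
        using A(2)
      proof eventually_elim
        case (elim \<omega>)
        consider "\<omega> \<notin> A" | "\<omega> \<in> B 0" | "\<omega> \<in> A - B 0" by blast
        then show ?case
        proof cases
          case 1
          then show ?thesis by simp
        next
          case 2
          then have "X (t 0) \<omega> \<le> \<eta>" using elim BA[of 0] by (auto simp: t_def)
          then have "c * (\<eta> + \<kappa>) \<le> c * (X (t 0) \<omega> + \<kappa>)"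
            using pos by (intro mult_left_mono_neg) auto
          then have "?g \<le> ennreal (exp (c * (X (t 0) \<omega> + \<kappa>)))" by (simp add: ennreal_leI)
          then have "?e * ?g \<le> ?e * ennreal (exp (c * (X (t 0) \<omega> + \<kappa>)))" by (rule mult_left_mono) simp
          moreover have "\<omega> \<in> A" using 2 BA[of 0] by blast
          ultimately show ?thesis using 2 by (simp add: U_def)
        next
          case 3
          then have "X (t 0) \<omega> \<le> 0" by (auto simp: B_def t_def not_less)
          then have "?e \<le> D \<omega>" by (rule D_ge)
          moreover have "?e * ?g \<le> ?e * 1" using g1 by (rule mult_left_mono) simp
          ultimately show ?thesis using 3 by (auto simp: indicator_def intro: order_trans)
        qed
      qed
    qed
    also have "\<dots> = \<Phi> 0"
      unfolding \<Phi>_def by (simp add: nn_integral_add nn_integral_cmult)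
    finally show ?thesis .
  qed
  have top: "\<Phi> n \<le> ennreal (exp (- \<beta> * t n)) + (\<integral>\<^sup>+\<omega>. indicator A \<omega> * D \<omega> \<partial>M)" for n
    unfolding \<Phi>_def
  proof (rule add_mono)
    have "U n \<omega> \<le> 1" for \<omega>
    proof (cases "\<omega> \<in> B n")
      case True
      then have "c * (X (t n) \<omega> + \<kappa>) \<le> 0"
        using Bpos[OF True] pos by (intro mult_nonpos_nonneg) auto
      then show ?thesis by (simp add: U_def indicator_def)
    qed (simp add: U_def)
    then have "(\<integral>\<^sup>+\<omega>. U n \<omega> \<partial>M) \<le> (\<integral>\<^sup>+\<omega>. 1 \<partial>M)" by (intro nn_integral_mono)
    then have "(\<integral>\<^sup>+\<omega>. U n \<omega> \<partial>M) \<le> 1" by (simp add: emeasure_space_1)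
    then show "ennreal (exp (- \<beta> * t n)) * (\<integral>\<^sup>+\<omega>. U n \<omega> \<partial>M) \<le> ennreal (exp (- \<beta> * t n))"
      using mult_left_mono[of "\<integral>\<^sup>+\<omega>. U n \<omega> \<partial>M" 1 "ennreal (exp (- \<beta> * t n))"] by simp
    show "(\<integral>\<^sup>+\<omega>. indicator (A - B n) \<omega> * D \<omega> \<partial>M) \<le> (\<integral>\<^sup>+\<omega>. indicator A \<omega> * D \<omega> \<partial>M)"
      by (intro nn_integral_mono) (auto simp: indicator_def)
  qed
  have "exp (- \<beta> * t n) = exp (- \<beta> * (real k * h)) * exp (- \<beta> * h) ^ n" for n
    unfolding exp_of_nat_mult[symmetric] exp_add[symmetric] t_def by (simp add: algebra_simps)
  moreover have "(\<lambda>n. exp (- \<beta> * (real k * h)) * exp (- \<beta> * h) ^ n) \<longlonglongrightarrow> exp (- \<beta> * (real k * h)) * 0"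
    using pos by (intro tendsto_mult tendsto_const LIMSEQ_power_zero) simp
  ultimately have "(\<lambda>n. exp (- \<beta> * t n)) \<longlonglongrightarrow> 0" by simp
  then have "(\<lambda>n. ennreal (exp (- \<beta> * t n))) \<longlonglongrightarrow> 0"
    using tendsto_ennrealI[of "\<lambda>n. exp (- \<beta> * t n)" 0] by simp
  then have "(\<lambda>n. ennreal (exp (- \<beta> * t n)) + (\<integral>\<^sup>+\<omega>. indicator A \<omega> * D \<omega> \<partial>M))
     \<longlonglongrightarrow> 0 + (\<integral>\<^sup>+\<omega>. indicator A \<omega> * D \<omega> \<partial>M)"
    by (intro tendsto_add tendsto_const)
  then have "\<Phi> 0 \<le> 0 + (\<integral>\<^sup>+\<omega>. indicator A \<omega> * D \<omega> \<partial>M)"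
    by (rule tendsto_lowerbound) (simp_all only: order_trans[OF incr top] eventually_True
        trivial_limit_sequentially not_False_eq_True)
  then show ?thesis using base unfolding D_def by simp
qed

section \<open>Upper bound for Brownian motion with drift\<close>

text \<open>Optional stopping of the exponential martingale at the first grid time at which \<open>Y\<close> is at most \<open>a\<close>.
  The overshoot below \<open>a\<close> has the favourable sign because \<open>r < 0\<close>.\<close>

lemma grid_hit_drifted_le:
  assumes pos: "h > 0" "r < 0"
    and q: "\<beta> = exponent \<mu> \<sigma> r"
    and Y: "Y = (\<lambda>t \<omega>. x + \<mu> * t + \<sigma> * W t \<omega>)"
    and W: "continuous_adapted M F W" "AE \<omega> in M. W 0 \<omega> = 0"
  shows "(\<Sum>k. ennreal (exp (- \<beta> * (real k * h))) * emeasure M (grid_hit M h a Y k))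
      \<le> ennreal (exp (r * (x - a)))"
proof -
  define H where "H = grid_hit M h a Y"
  define B where "B = (\<lambda>n. {\<omega> \<in> space M. \<forall>j\<in>{..n}. a < Y (real j * h) \<omega>})"
  define t where "t = (\<lambda>n. real n * h)"
  have t: "0 \<le> t n" "t (Suc n) = t n + h" for n using pos by (auto simp: t_def algebra_simps)
  have YF: "Y s \<in> borel_measurable (F s)" if "0 \<le> s" for s
  proof -
    have [measurable]: "W s \<in> borel_measurable (F s)"
      using W(1) that by (simp add: continuous_adapted_def)
    show ?thesis unfolding Y by measurable
  qed
  have meas: "Y (real j * h) \<in> borel_measurable (F (t n))" if "j \<le> n" for j n
    by (rule measurable_F_mono[OF YF]) (use pos that in \<open>simp_all add: t_def mult_right_mono\<close>)
  have BF: "B n \<in> sets (F (t n))" for n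
  proof -
    have "{\<omega> \<in> space (F (t n)). a < Y (real j * h) \<omega>} \<in> sets (F (t n))" if "j \<in> {..n}" for j
      by (rule borel_measurable_less) (use that meas in auto)
    then have "{\<omega> \<in> space (F (t n)). \<forall>j\<in>{..n}. a < Y (real j * h) \<omega>} \<in> sets (F (t n))"
      by (rule sets.sets_Collect_finite_All) simp_all
    then show ?thesis by (simp add: B_def)
  qed
  have BM[measurable]: "B n \<in> sets M" for n using BF sets_F_subset by blast
  have YM[measurable]: "Y (t n) \<in> borel_measurable M" for n using YF[OF t(1)] by (rule measurable_F_M)
  have HM[measurable]: "H n \<in> sets M" for n
    unfolding H_def
    by (rule grid_hit_sets) (use pos measurable_F_M[OF meas] in auto)
  have split: "B n = B (Suc n) \<union> H (Suc n)" "B (Suc n) \<inter> H (Suc n) = {}" for n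
    unfolding B_def H_def grid_hit_def by (auto simp: atMost_Suc less_Suc_eq_le not_less simp del: of_nat_Suc)
  have Hle: "Y (t n) \<omega> \<le> a" if "\<omega> \<in> H n" for n \<omega>
    using that by (simp add: H_def grid_hit_def t_def)
  define E where "E = (\<lambda>n \<omega>. ennreal (exp (r * Y (t n) \<omega>)))"
  have E[measurable]: "E n \<in> borel_measurable M" for n unfolding E_def by measurable
  define e where "e = (\<lambda>n. ennreal (exp (- \<beta> * t n)))"
  define g where "g = ennreal (exp (r * a))"
  have gE: "g \<le> E n \<omega>" if "\<omega> \<in> H n" for n \<omega>
    using Hle[OF that] pos(2) unfolding g_def E_def by (simp add: mult_left_mono_neg ennreal_leI)
  have bound: "e n * (\<integral>\<^sup>+\<omega>. indicator (B n) \<omega> * E n \<omega> \<partial>M) + (\<Sum>k\<le>n. e k * g * emeasure M (H k))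
      \<le> ennreal (exp (r * x))" for n
  proof (induction n)
    case 0
    have "e 0 * (\<integral>\<^sup>+\<omega>. indicator (B 0) \<omega> * E 0 \<omega> \<partial>M) + (\<Sum>k\<le>0. e k * g * emeasure M (H k))
      = (\<integral>\<^sup>+\<omega>. indicator (B 0) \<omega> * E 0 \<omega> \<partial>M) + (\<integral>\<^sup>+\<omega>. g * indicator (H 0) \<omega> \<partial>M)"
      by (simp add: e_def t_def nn_integral_cmult_indicator)
    also have "\<dots> = (\<integral>\<^sup>+\<omega>. indicator (B 0) \<omega> * E 0 \<omega> + g * indicator (H 0) \<omega> \<partial>M)"
      by (rule nn_integral_add[symmetric]) measurable
    also have "\<dots> \<le> (\<integral>\<^sup>+\<omega>. ennreal (exp (r * x)) \<partial>M)"
    proof (rule nn_integral_mono_AE)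
      show "AE \<omega> in M. indicator (B 0) \<omega> * E 0 \<omega> + g * indicator (H 0) \<omega> \<le> ennreal (exp (r * x))"
        using W(2)
      proof eventually_elim
        case (elim \<omega>)
        have "E 0 \<omega> = ennreal (exp (r * x))" unfolding E_def Y t_def using elim by simp
        moreover have "\<omega> \<notin> B 0 \<or> \<omega> \<notin> H 0" by (auto simp: B_def H_def grid_hit_def)
        ultimately show ?case using gE[of \<omega> 0] by (auto simp: indicator_def)
      qed
    qed
    finally show ?case by (simp add: emeasure_space_1)
  next
    case (Suc n)
    define f where "f = (\<lambda>y. ennreal (exp (r * (\<mu> * h + \<sigma> * y))))"
    have [measurable]: "f \<in> borel_measurable borel" unfolding f_def by measurable
    have EF: "(\<lambda>\<omega>. indicator (B n) \<omega> * E n \<omega>) \<in> borel_measurable (F (t n))"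
      unfolding E_def using YF[OF t(1), of n] BF[of n] by measurable
    have "(\<integral>\<^sup>+\<omega>. indicator (B n) \<omega> * E (Suc n) \<omega> \<partial>M)
      = (\<integral>\<^sup>+\<omega>. (indicator (B n) \<omega> * E n \<omega>) * f (W (t n + h) \<omega> - W (t n) \<omega>) \<partial>M)"
    proof (rule nn_integral_cong)
      fix \<omega>
      have "r * Y (t (Suc n)) \<omega> = r * Y (t n) \<omega> + r * (\<mu> * h + \<sigma> * (W (t n + h) \<omega> - W (t n) \<omega>))"
        unfolding t(2) Y by (simp add: algebra_simps)
      then have "E (Suc n) \<omega> = E n \<omega> * f (W (t n + h) \<omega> - W (t n) \<omega>)"
        unfolding E_def f_def by (simp add: exp_add ennreal_mult)
      then show "indicator (B n) \<omega> * E (Suc n) \<omega> = (indicator (B n) \<omega> * E n \<omega>) * f (W (t n + h) \<omega> - W (t n) \<omega>)"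
        by (simp add: mult.assoc)
    qed
    also have "\<dots> = (\<integral>\<^sup>+\<omega>. indicator (B n) \<omega> * E n \<omega> \<partial>M) *
       (\<integral>\<^sup>+y. ennreal (normal_density 0 (sqrt (t n + h - t n)) y) * f y \<partial>lborel)"
      using t(1) pos by (intro nn_integral_indep_increment EF) auto
    also have "(\<integral>\<^sup>+y. ennreal (normal_density 0 (sqrt (t n + h - t n)) y) * f y \<partial>lborel)
        = ennreal (exp (\<beta> * h))"
      unfolding f_def q using nn_integral_exp_step[OF pos(1)] by simp
    finally have "e (Suc n) * (\<integral>\<^sup>+\<omega>. indicator (B n) \<omega> * E (Suc n) \<omega> \<partial>M)
      = (e (Suc n) * ennreal (exp (\<beta> * h))) * (\<integral>\<^sup>+\<omega>. indicator (B n) \<omega> * E n \<omega> \<partial>M)"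
      by (simp only: mult_ac)
    also have "e (Suc n) * ennreal (exp (\<beta> * h)) = e n"
      unfolding e_def t(2) by (simp add: ennreal_mult[symmetric] exp_add[symmetric] algebra_simps)
    finally have mart: "e n * (\<integral>\<^sup>+\<omega>. indicator (B n) \<omega> * E n \<omega> \<partial>M)
        = e (Suc n) * (\<integral>\<^sup>+\<omega>. indicator (B n) \<omega> * E (Suc n) \<omega> \<partial>M)" ..
    have "(\<integral>\<^sup>+\<omega>. indicator (B (Suc n)) \<omega> * E (Suc n) \<omega> \<partial>M) + g * emeasure M (H (Suc n))
      = (\<integral>\<^sup>+\<omega>. indicator (B (Suc n)) \<omega> * E (Suc n) \<omega> \<partial>M) + (\<integral>\<^sup>+\<omega>. g * indicator (H (Suc n)) \<omega> \<partial>M)"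
      by (simp add: nn_integral_cmult_indicator)
    also have "\<dots> = (\<integral>\<^sup>+\<omega>. indicator (B (Suc n)) \<omega> * E (Suc n) \<omega> + g * indicator (H (Suc n)) \<omega> \<partial>M)"
      by (rule nn_integral_add[symmetric]) measurable
    also have "\<dots> \<le> (\<integral>\<^sup>+\<omega>. indicator (B n) \<omega> * E (Suc n) \<omega> \<partial>M)"
    proof (rule nn_integral_mono)
      fix \<omega>
      consider "\<omega> \<in> B (Suc n)" "\<omega> \<notin> H (Suc n)" "\<omega> \<in> B n" | "\<omega> \<in> H (Suc n)" "\<omega> \<notin> B (Suc n)" "\<omega> \<in> B n"
        | "\<omega> \<notin> H (Suc n)" "\<omega> \<notin> B (Suc n)"
        using split[of n] by blast
      then show "indicator (B (Suc n)) \<omega> * E (Suc n) \<omega> + g * indicator (H (Suc n)) \<omega>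
          \<le> indicator (B n) \<omega> * E (Suc n) \<omega>"
        using gE[of \<omega> "Suc n"] by cases simp_all
    qed
    finally have "e (Suc n) * ((\<integral>\<^sup>+\<omega>. indicator (B (Suc n)) \<omega> * E (Suc n) \<omega> \<partial>M) + g * emeasure M (H (Suc n)))
      \<le> e n * (\<integral>\<^sup>+\<omega>. indicator (B n) \<omega> * E n \<omega> \<partial>M)"
      unfolding mart by (rule mult_left_mono) simp
    then have "e (Suc n) * (\<integral>\<^sup>+\<omega>. indicator (B (Suc n)) \<omega> * E (Suc n) \<omega> \<partial>M) + (\<Sum>k\<le>Suc n. e k * g *
        emeasure M (H k))
      \<le> e n * (\<integral>\<^sup>+\<omega>. indicator (B n) \<omega> * E n \<omega> \<partial>M) + (\<Sum>k\<le>n. e k * g * emeasure M (H k))"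
      by (simp add: distrib_left add_ac mult.assoc add_left_mono)
    then show ?case using Suc.IH by (rule order_trans)
  qed
  have "(\<Sum>k. e k * g * emeasure M (H k)) \<le> ennreal (exp (r * x))"
  proof (rule suminf_le_const)
    fix n
    have "(\<Sum>k<n. e k * g * emeasure M (H k)) \<le> (\<Sum>k\<le>n. e k * g * emeasure M (H k))"
      by (intro sum_mono2) auto
    also have "\<dots> \<le> ennreal (exp (r * x))"
      by (rule order_trans[OF _ bound[of n]]) simp
    finally show "(\<Sum>k<n. e k * g * emeasure M (H k)) \<le> ennreal (exp (r * x))" .
  qed simp
  then have "ennreal (exp (- (r * a))) * (\<Sum>k. g * (e k * emeasure M (H k)))
      \<le> ennreal (exp (- (r * a))) * ennreal (exp (r * x))"
    by (intro mult_left_mono) (simp_all add: mult_ac)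
  also have "ennreal (exp (- (r * a))) * ennreal (exp (r * x)) = ennreal (exp (r * (x - a)))"
    by (simp add: ennreal_mult[symmetric] exp_add[symmetric] algebra_simps)
  also have "ennreal (exp (- (r * a))) * (\<Sum>k. g * (e k * emeasure M (H k)))
     = (ennreal (exp (- (r * a))) * g) * (\<Sum>k. e k * emeasure M (H k))"
    by (simp add: ennreal_suminf_cmult mult.assoc)
  also have "ennreal (exp (- (r * a))) * g = 1"
    unfolding g_def by (simp add: ennreal_mult[symmetric] exp_add[symmetric])
  finally show ?thesis by (simp add: e_def t_def H_def)
qed

section \<open>Dependence of the ruin transform on the threshold\<close>

lemma ruin_time_borel:
  "continuous_adapted M F X \<Longrightarrow> ruin_time X \<in> borel_measurable M"
  using continuous_adaptedD[of X] by (intro ruin_time_measurable) blast+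

lemma discount_ruin_integrable:
  assumes "\<beta> > 0" "continuous_adapted M F X"
  shows "integrable M (\<lambda>\<omega>. discount \<beta> (ruin_time X \<omega>))"
proof (rule integrable_const_bound[where B = 1])
  show "AE \<omega> in M. norm (discount \<beta> (ruin_time X \<omega>)) \<le> 1"
    using discount_le_1[OF assms(1) ruin_time_nonneg, of X] by (intro AE_I2) simp
  show "(\<lambda>\<omega>. discount \<beta> (ruin_time X \<omega>)) \<in> borel_measurable M"
    using ruin_time_borel[OF assms(2)] by measurable
qed

lemma ennreal_ruin_transform:
  assumes "\<beta> > 0" "continuous_adapted M F X"
  shows "ennreal (ruin_transform M \<beta> X) = (\<integral>\<^sup>+\<omega>. ennreal (discount \<beta> (ruin_time X \<omega>)) \<partial>M)"
  unfolding ruin_transform_def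
  by (rule nn_integral_eq_integral[symmetric]) (simp_all add: discount_ruin_integrable assms)

lemma ruin_transform_bounds:
  assumes "\<beta> > 0" "continuous_adapted M F X"
  shows "0 \<le> ruin_transform M \<beta> X" "ruin_transform M \<beta> X \<le> 1"
proof -
  show "0 \<le> ruin_transform M \<beta> X"
    unfolding ruin_transform_def by (rule integral_nonneg_AE) simp
  have "ruin_transform M \<beta> X \<le> (\<integral>\<omega>. 1 \<partial>M)"
    unfolding ruin_transform_def using discount_ruin_integrable[OF assms]
    by (rule integral_mono) (simp_all add: discount_le_1[OF assms(1) ruin_time_nonneg])
  then show "ruin_transform M \<beta> X \<le> 1" by (simp add: prob_space)
qed

lemma solutionD:
  assumes "threshold_sde_solution M F W \<mu> \<sigma> L x b X"
  shows "continuous_adapted M F X"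
    and "AE \<omega> in M. \<omega> \<in> space M \<and> (\<forall>t\<ge>0. X t \<omega>
        = x + (LBINT s:{0..t}. \<mu> - L * indicator {b..} (X s \<omega>)) + \<sigma> * W t \<omega>)"
  using assms AE_space[of M] unfolding threshold_sde_solution_def by auto

lemma solution_step_le:
  assumes "L > 0" "threshold_sde_solution M F W \<mu> \<sigma> L x b X" "t \<ge> 0" "h > 0"
  shows "AE \<omega> in M. X (t + h) \<omega> \<le> X t \<omega> + (\<mu> * h + \<sigma> * (W (t + h) \<omega> - W t \<omega>))"
  using solutionD(2)[OF assms(2)]
proof eventually_elim
  case (elim \<omega>)
  then have cont: "continuous_on {0..} (\<lambda>t. X t \<omega>)"
    using continuous_adaptedD(3)[OF solutionD(1)[OF assms(2)]] by blast
  let ?u = "\<lambda>s. \<mu> - L * indicator {b..} (X s \<omega>)"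
  have int: "set_integrable lborel {r..s} ?u" if "0 \<le> r" for r s
    using threshold_drift_integrable[OF cont that] .
  have split: "{0..t + h} = {0..t} \<union> {t<..t + h}" using assms by auto
  have i: "set_integrable lborel {t<..t + h} ?u"
    by (rule set_integrable_subset[OF int[OF assms(3)]]) auto
  have "(LBINT s:{0..t + h}. ?u s) = (LBINT s:{0..t}. ?u s) + (LBINT s:{t<..t + h}. ?u s)"
    unfolding split by (rule set_integral_Un) (use i int in auto)
  moreover have "(LBINT s:{t<..t + h}. ?u s) \<le> (LBINT s:{t<..t + h}. \<mu>)"
  proof (rule set_integral_mono[OF i])
    have "set_integrable lborel {t..t + h} (\<lambda>_. \<mu>)"
      by (simp add: set_integrable_def emeasure_lborel_Icc_eq)
    then show "set_integrable lborel {t<..t + h} (\<lambda>_. \<mu>)"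
      by (rule set_integrable_subset) auto
  qed (use \<open>L > 0\<close> in simp)
  moreover have "(LBINT s:{t<..t + h}. \<mu>) = \<mu> * h"
    using assms by (simp add: set_lebesgue_integral_def mult.commute)
  moreover have "X t \<omega> = x + (LBINT s:{0..t}. ?u s) + \<sigma> * W t \<omega>"
    "X (t + h) \<omega> = x + (LBINT s:{0..t + h}. ?u s) + \<sigma> * W (t + h) \<omega>"
    using elim assms by auto
  ultimately show ?case by (simp add: right_diff_distrib)
qed

text \<open>The upper bound holds because \<open>X + (b' - b)\<close> solves the equation with threshold \<open>b'\<close> and the larger
  starting point \<open>x + (b' - b)\<close>.\<close>

lemma solution_comparison:
  assumes "L > 0" "b \<le> b'"
    and X: "threshold_sde_solution M F W \<mu> \<sigma> L x b X"
    and X': "threshold_sde_solution M F W \<mu> \<sigma> L x b' X'"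
  shows "AE \<omega> in M. \<forall>t\<ge>0. X t \<omega> \<le> X' t \<omega> \<and> X' t \<omega> \<le> X t \<omega> + (b' - b)"
  using solutionD(2)[OF X] solutionD(2)[OF X']
proof eventually_elim
  case (elim \<omega>)
  note cont = continuous_adaptedD(3)[OF solutionD(1)[OF X], of \<omega>]
      continuous_adaptedD(3)[OF solutionD(1)[OF X'], of \<omega>]
  have c: "continuous_on {0..} (\<lambda>t. X t \<omega>)" "continuous_on {0..} (\<lambda>t. X' t \<omega>)" using cont elim by blast+
  note int = threshold_drift_integrable[OF c(1) order_refl] threshold_drift_integrable[OF c(2) order_refl]
  have "X t \<omega> \<le> X' t \<omega>" if "t \<ge> 0" for t
  proof (rule path_comparison[OF c int])
    show "X t \<omega> = x + (LBINT s:{0..t}. \<mu> - L * indicator {b..} (X s \<omega>)) + \<sigma> * W t \<omega>" if "t \<ge> 0" for t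
      using elim that by blast
    show "X' t \<omega> = x + (LBINT s:{0..t}. \<mu> - L * indicator {b'..} (X' s \<omega>)) + \<sigma> * W t \<omega>" if "t \<ge> 0" for t
      using elim that by blast
    show "\<mu> - L * indicator {b..} (X s \<omega>) \<le> \<mu> - L * indicator {b'..} (X' s \<omega>)" if "X' s \<omega> < X s \<omega>" for s
      using that \<open>b \<le> b'\<close> \<open>L > 0\<close> by (auto simp: indicator_def)
  qed (use that in auto)
  moreover have "X' t \<omega> \<le> X t \<omega> + (b' - b)" if "t \<ge> 0" for t
  proof (rule path_comparison[OF c(2) _ int(2) int(1)])
    show "continuous_on {0..} (\<lambda>t. X t \<omega> + (b' - b))" using c(1) by (intro continuous_intros)
    show "X' t \<omega> = x + (LBINT s:{0..t}. \<mu> - L * indicator {b'..} (X' s \<omega>)) + \<sigma> * W t \<omega>" if "t \<ge> 0" for t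
      using elim that by blast
    show "X t \<omega> + (b' - b) = (x + (b' - b)) + (LBINT s:{0..t}. \<mu> - L * indicator {b..} (X s \<omega>)) + \<sigma> * W
        t \<omega>" if "t \<ge> 0" for t
    proof -
      have "X t \<omega> = x + (LBINT s:{0..t}. \<mu> - L * indicator {b..} (X s \<omega>)) + \<sigma> * W t \<omega>" using elim that by blast
      then show ?thesis by linarith
    qed
    show "\<mu> - L * indicator {b'..} (X' s \<omega>) \<le> \<mu> - L * indicator {b..} (X s \<omega>)"
        if "X s \<omega> + (b' - b) < X' s \<omega>" for s
      using that \<open>L > 0\<close> by (auto simp: indicator_def)
  qed (use that \<open>b \<le> b'\<close> in auto)
  ultimately show ?case by blast
qed

lemma solution_le_drifted:
  assumes "L > 0" and X: "threshold_sde_solution M F W \<mu> \<sigma> L x b X"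
  shows "AE \<omega> in M. \<forall>t\<ge>0. X t \<omega> \<le> x + \<mu> * t + \<sigma> * W t \<omega> \<and>
     ((\<forall>s\<in>{0..t}. x + \<mu> * s + \<sigma> * W s \<omega> < b) \<longrightarrow> X t \<omega> = x + \<mu> * t + \<sigma> * W t \<omega>)"
  using solutionD(2)[OF X]
proof eventually_elim
  case (elim \<omega>)
  have c: "continuous_on {0..} (\<lambda>t. X t \<omega>)" using continuous_adaptedD(3)[OF solutionD(1)[OF X]] elim by blast
  have "X t \<omega> \<le> x + \<mu> * t + \<sigma> * W t \<omega>" if "t \<ge> 0" for t
  proof -
    have "(LBINT s:{0..t}. \<mu> - L * indicator {b..} (X s \<omega>)) \<le> (LBINT s:{0..t}. \<mu>)"
      using threshold_drift_integrable[OF c order_refl] \<open>L > 0\<close>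
      by (intro set_integral_mono) (auto simp: set_integrable_def emeasure_lborel_Icc_eq)
    also have "\<dots> = \<mu> * t" using that by (rule set_lebesgue_integral_const_Icc)
    finally show ?thesis using elim that by auto
  qed
  moreover have "X t \<omega> = x + \<mu> * t + \<sigma> * W t \<omega>"
    if "t \<ge> 0" "\<forall>s\<in>{0..t}. x + \<mu> * s + \<sigma> * W s \<omega> < b" for t
  proof -
    have "X s \<omega> < b" if "s \<in> {0..t}" for s
      using that calculation[of s] \<open>\<forall>s\<in>{0..t}. x + \<mu> * s + \<sigma> * W s \<omega> < b\<close> by force
    then have "(LBINT s:{0..t}. \<mu> - L * indicator {b..} (X s \<omega>)) = (LBINT s:{0..t}. \<mu>)"
      by (intro set_lebesgue_integral_cong) (auto simp: indicator_def not_le[symmetric])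
    also have "\<dots> = \<mu> * t" using that(1) by (rule set_lebesgue_integral_const_Icc)
    finally show ?thesis using elim that(1) by auto
  qed
  ultimately show ?case by blast
qed

lemma ruin_transform_antimono:
  assumes "\<beta> > 0" "L > 0" "b \<le> b'"
    and X: "threshold_sde_solution M F W \<mu> \<sigma> L x b X"
    and X': "threshold_sde_solution M F W \<mu> \<sigma> L x b' X'"
  shows "ruin_transform M \<beta> X' \<le> ruin_transform M \<beta> X"
  unfolding ruin_transform_def
proof (rule integral_mono_AE)
  show "AE \<omega> in M. discount \<beta> (ruin_time X' \<omega>) \<le> discount \<beta> (ruin_time X \<omega>)"
    using solution_comparison[OF assms(2,3) X X']
    by eventually_elim (intro discount_antimono[OF \<open>\<beta> > 0\<close>] ruin_time_nonneg ruin_time_mono, blast)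
qed (intro discount_ruin_integrable \<open>\<beta> > 0\<close> solutionD(1)[OF X] solutionD(1)[OF X'])+

text \<open>With \<open>\<epsilon> = b' - b\<close>, the argument observes \<open>X\<close> on the grid at level \<open>\<epsilon>\<close>. At that time \<open>X'\<close> is at most
  \<open>2 * \<epsilon>\<close>, and \<open>ruin_lower_bound\<close> with \<open>\<kappa> = \<epsilon>\<close> accounts for the factor \<open>3\<close>.\<close>

lemma ruin_transform_lower:
  assumes "\<beta> > 0" "L > 0" "b < b'" "c < 0" "\<beta> < exponent \<mu> \<sigma> c"
    and X: "threshold_sde_solution M F W \<mu> \<sigma> L x b X"
    and X': "threshold_sde_solution M F W \<mu> \<sigma> L x b' X'"
  shows "exp (3 * c * (b' - b)) * ruin_transform M \<beta> X \<le> ruin_transform M \<beta> X'"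
proof -
  define \<epsilon> where "\<epsilon> = b' - b"
  have "\<epsilon> > 0" using assms by (simp add: \<epsilon>_def)
  note cX = solutionD(1)[OF X] and cX' = solutionD(1)[OF X']
  define D where "D = (\<lambda>\<omega>. ennreal (discount \<beta> (ruin_time X' \<omega>)))"
  have D[measurable]: "D \<in> borel_measurable M"
    unfolding D_def using ruin_time_borel[OF cX'] by measurable
  define g where "g = ennreal (exp (3 * c * \<epsilon>))"
  have "(\<integral>\<^sup>+\<omega>. ennreal (discount \<beta> (ruin_time X \<omega>)) \<partial>M) \<le> ennreal (exp (- (3 * c * \<epsilon>))) * (\<integral>\<^sup>+\<omega>. D \<omega> \<partial>M)"
  proof (rule nn_integral_discount_ruin_le[OF \<open>\<beta> > 0\<close> \<open>\<epsilon> > 0\<close>])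
    show "\<forall>\<^sub>F n in sequentially.
      (\<Sum>k. ennreal (exp (- \<beta> * (real k * (1 / real (Suc n))))) * emeasure M (grid_hit M (1 / real (Suc
          n)) \<epsilon> X k))
        \<le> ennreal (exp (- (3 * c * \<epsilon>))) * (\<integral>\<^sup>+\<omega>. D \<omega> \<partial>M)"
      using eventually_truncated_step_gap[OF \<open>\<epsilon> > 0\<close> \<open>\<beta> > 0\<close> assms(5)]
    proof eventually_elim
      case (elim n)
      define h where "h = 1 / real (Suc n)"
      have "h > 0" by (simp add: h_def)
      define A where "A = grid_hit M h \<epsilon> X"
      have AF: "A k \<in> sets (F (real k * h))" for k
        unfolding A_def
      proof (rule grid_hit_sets)
        show "X (real j * h) \<in> borel_measurable (F (real k * h))" if "j \<le> k" for j
          by (rule measurable_F_mono[OF continuous_adaptedD(1)[OF cX]])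
            (use that \<open>h > 0\<close> in \<open>simp_all add: mult_right_mono\<close>)
      qed (simp_all add: \<open>h > 0\<close>)
      have AM[measurable]: "A k \<in> sets M" for k using AF sets_F_subset by blast
      have low: "ennreal (exp (- \<beta> * (real k * h))) * g * emeasure M (A k)
          \<le> (\<integral>\<^sup>+\<omega>. indicator (A k) \<omega> * D \<omega> \<partial>M)" for k
      proof -
        have "AE \<omega> in M. \<omega> \<in> A k \<longrightarrow> X' (real k * h) \<omega> \<le> 2 * \<epsilon>"
          using solution_comparison[OF \<open>L > 0\<close> less_imp_le[OF \<open>b < b'\<close>] X X']
        proof eventually_elim
          case (elim \<omega>)
          have "0 \<le> real k * h" using \<open>h > 0\<close> by simp
          then have "X' (real k * h) \<omega> \<le> X (real k * h) \<omega> + \<epsilon>" using elim by (simp add: \<epsilon>_def)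
          then show ?case by (auto simp: A_def grid_hit_def)
        qed
        from ruin_lower_bound[OF \<open>h > 0\<close> \<open>\<beta> > 0\<close> \<open>c < 0\<close> _ _ cX' solution_step_le[OF \<open>L > 0\<close> X' _ \<open>h > 0\<close>]
            nn_integral_exp_truncated_step[OF \<open>h > 0\<close> _ elim[folded h_def]] AF this]
        have "ennreal (exp (- \<beta> * (real k * h)) * exp (c * (2 * \<epsilon> + \<epsilon>))) * emeasure M (A k)
            \<le> (\<integral>\<^sup>+\<omega>. indicator (A k) \<omega> * ennreal (discount \<beta> (ruin_time X' \<omega>)) \<partial>M)"
          using \<open>\<epsilon> > 0\<close> by simp
        then show ?thesis unfolding g_def D_def by (simp add: ennreal_mult mult_ac)
      qed
      have ind: "(\<Sum>k. indicator (A k) \<omega> * D \<omega>) \<le> D \<omega>" for \<omega>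
      proof (cases "\<exists>k. \<omega> \<in> A k")
        case True
        then obtain k where "\<omega> \<in> A k" by blast
        then have "(\<Sum>k. D \<omega> * indicator (A k) \<omega>) = D \<omega>"
          unfolding A_def by (intro suminf_cmult_indicator[OF disjoint_family_grid_hit])
        then show ?thesis by (simp add: mult.commute)
      next
        case False
        then show ?thesis by simp
      qed
      have "g * (\<Sum>k. ennreal (exp (- \<beta> * (real k * h))) * emeasure M (A k))
          = (\<Sum>k. g * (ennreal (exp (- \<beta> * (real k * h))) * emeasure M (A k)))"
        by (rule ennreal_suminf_cmult[symmetric])
      also have "\<dots> \<le> (\<Sum>k. \<integral>\<^sup>+\<omega>. indicator (A k) \<omega> * D \<omega> \<partial>M)"
        using low by (intro suminf_le) (simp_all add: mult_ac)
      also have "\<dots> = (\<integral>\<^sup>+\<omega>. (\<Sum>k. indicator (A k) \<omega> * D \<omega>) \<partial>M)"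
        by (rule nn_integral_suminf[symmetric]) measurable
      also have "\<dots> \<le> (\<integral>\<^sup>+\<omega>. D \<omega> \<partial>M)"
        by (rule nn_integral_mono[OF ind])
      finally have "ennreal (exp (- (3 * c * \<epsilon>))) * (g * (\<Sum>k. ennreal (exp (- \<beta> * (real k * h))) *
          emeasure M (A k)))
          \<le> ennreal (exp (- (3 * c * \<epsilon>))) * (\<integral>\<^sup>+\<omega>. D \<omega> \<partial>M)"
        by (rule mult_left_mono) simp
      moreover have "ennreal (exp (- (3 * c * \<epsilon>))) * g = 1"
        unfolding g_def by (simp add: ennreal_mult[symmetric] exp_add[symmetric])
      ultimately show ?case by (simp add: mult.assoc[symmetric] A_def h_def)
    qed
  qed (use continuous_adaptedD[OF cX] in blast)+
  then have "ennreal (ruin_transform M \<beta> X) \<le> ennreal (exp (- (3 * c * \<epsilon>))) * ennreal (ruin_transform M \<beta> X')"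
    unfolding D_def ennreal_ruin_transform[OF \<open>\<beta> > 0\<close> cX] ennreal_ruin_transform[OF \<open>\<beta> > 0\<close> cX'] .
  then have "ruin_transform M \<beta> X \<le> exp (- (3 * c * \<epsilon>)) * ruin_transform M \<beta> X'"
    using ruin_transform_bounds(1)[OF \<open>\<beta> > 0\<close> cX'] by (simp add: ennreal_mult[symmetric])
  then have "exp (3 * c * \<epsilon>) * ruin_transform M \<beta> X
      \<le> exp (3 * c * \<epsilon>) * (exp (- (3 * c * \<epsilon>)) * ruin_transform M \<beta> X')"
    by (rule mult_left_mono) simp
  also have "\<dots> = ruin_transform M \<beta> X'"
    unfolding mult.assoc[symmetric] exp_add[symmetric] by simp
  finally show ?thesis by (simp add: \<epsilon>_def)
qed

lemma ruin_transform_Lipschitz: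
  assumes "\<beta> > 0" "L > 0" "c < 0" "\<beta> < exponent \<mu> \<sigma> c"
    and X: "\<And>b. b \<ge> 0 \<Longrightarrow> threshold_sde_solution M F W \<mu> \<sigma> L x b (X b)"
  shows "(3 * \<bar>c\<bar>)-lipschitz_on {0..} (\<lambda>b. ruin_transform M \<beta> (X b))"
proof (rule lipschitz_onI)
  let ?w = "\<lambda>b. ruin_transform M \<beta> (X b)"
  have main: "\<bar>?w b' - ?w b\<bar> \<le> 3 * \<bar>c\<bar> * (b' - b)" if "0 \<le> b" "b < b'" for b b'
  proof -
    note S = X[OF that(1)] X[of b', OF order.trans[OF that(1) less_imp_le[OF that(2)]]]
    have "?w b' \<le> ?w b" using ruin_transform_antimono[OF assms(1,2) _ S] that by simp
    moreover have "exp (3 * c * (b' - b)) * ?w b \<le> ?w b'"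
      using ruin_transform_lower[OF assms(1,2) that(2) assms(3,4) S] .
    moreover have "(1 - exp (3 * c * (b' - b))) * ?w b \<le> (3 * \<bar>c\<bar> * (b' - b)) * 1"
    proof (rule mult_mono)
      show "1 - exp (3 * c * (b' - b)) \<le> 3 * \<bar>c\<bar> * (b' - b)"
      proof -
        have "3 * \<bar>c\<bar> * (b' - b) = - (3 * c * (b' - b))" using \<open>c < 0\<close> by simp
        then show ?thesis using exp_ge_add_one_self[of "3 * c * (b' - b)"] by linarith
      qed
    qed (use ruin_transform_bounds[OF assms(1) solutionD(1)[OF S(1)]] that in auto)
    ultimately show ?thesis by (simp add: left_diff_distrib)
  qed
  fix b b' :: real assume "b \<in> {0..}" "b' \<in> {0..}"
  then consider "b = b'" | "0 \<le> b" "b < b'" | "0 \<le> b'" "b' < b" by (cases b b' rule: linorder_cases) auto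
  then show "dist (?w b) (?w b') \<le> 3 * \<bar>c\<bar> * dist b b'"
  proof cases
    case 2
    then show ?thesis using main[OF 2] by (simp add: dist_real_def abs_minus_commute)
  next
    case 3
    then show ?thesis using main[OF 3] by (simp add: dist_real_def)
  qed simp
qed simp

text \<open>Below the threshold the solution follows the Brownian motion \<open>Y\<close> with drift, and every path of \<open>Y\<close>
  is bounded on bounded time intervals, so the ruin transforms converge to that of \<open>Y\<close>. The
  parameter \<open>a\<close> leaves room for the grid level in the bound for \<open>Y\<close>.\<close>

lemma ruin_transform_large_threshold:
  assumes "\<beta> > 0" "L > 0" and r: "r < 0" "exponent \<mu> \<sigma> r = \<beta>"
    and X: "\<And>b. b \<ge> 0 \<Longrightarrow> threshold_sde_solution M F W \<mu> \<sigma> L x b (X b)"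
    and "a > 0" and \<alpha>: "exp (r * (x - a)) < \<alpha>"
  shows "\<forall>\<^sub>F n in sequentially. ruin_transform M \<beta> (X (real n)) < \<alpha>"
proof -
  define Y where "Y = (\<lambda>t \<omega>. x + \<mu> * t + \<sigma> * W t \<omega>)"
  have W: "continuous_adapted M F W" "AE \<omega> in M. W 0 \<omega> = 0"
    using brownian_motion unfolding brownian_motion_def by blast+
  have Y: "continuous_adapted M F Y"
    unfolding continuous_adapted_def
  proof (intro conjI allI impI ballI)
    fix t :: real assume "0 \<le> t"
    then have [measurable]: "W t \<in> borel_measurable (F t)" by (rule continuous_adaptedD(1)[OF W(1)])
    show "Y t \<in> borel_measurable (F t)" unfolding Y_def by measurable
  next
    fix \<omega> assume "\<omega> \<in> space M"
    then show "continuous_on {0..} (\<lambda>t. Y t \<omega>)"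
      unfolding Y_def by (intro continuous_intros continuous_adaptedD(3)[OF W(1)])
  qed
  have cX: "continuous_adapted M F (X (real n))" for n by (rule solutionD(1)[OF X]) simp
  have "AE \<omega> in M. \<forall>n. \<forall>t\<ge>0. X (real n) t \<omega> \<le> Y t \<omega> \<and>
      ((\<forall>s\<in>{0..t}. Y s \<omega> < real n) \<longrightarrow> X (real n) t \<omega> = Y t \<omega>)"
    unfolding AE_all_countable Y_def using solution_le_drifted[OF \<open>L > 0\<close> X] by simp
  then have conv: "AE \<omega> in M. (\<lambda>n. discount \<beta> (ruin_time (X (real n)) \<omega>)) \<longlonglongrightarrow> discount \<beta> (ruin_time Y \<omega>)"
    using AE_space
  proof eventually_elim
    case (elim \<omega>)
    have cont: "continuous_on {0..} (\<lambda>t. Y t \<omega>)" by (rule continuous_adaptedD(3)[OF Y elim(2)])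
    have agree: "\<forall>\<^sub>F n in sequentially. \<forall>s\<in>{0..t}. X (real n) s \<omega> = Y s \<omega>" for t
    proof -
      have "compact ((\<lambda>s. Y s \<omega>) ` {0..t})"
        by (intro compact_continuous_image continuous_on_subset[OF cont]) auto
      then have "bdd_above ((\<lambda>s. Y s \<omega>) ` {0..t})" by (intro bounded_imp_bdd_above compact_imp_bounded)
      then obtain K where K: "\<And>s. s \<in> {0..t} \<Longrightarrow> Y s \<omega> \<le> K" unfolding bdd_above_def by blast
      obtain N :: nat where "K < real N" using reals_Archimedean2 by blast
      show ?thesis
      proof (rule eventually_sequentiallyI[of N], rule ballI)
        fix n s assume "N \<le> n" "s \<in> {0..t}"
        have "Y u \<omega> < real n" if "u \<in> {0..s}" for u
        proof -
          have "Y u \<omega> \<le> K" using that \<open>s \<in> {0..t}\<close> by (intro K) simp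
          also have "\<dots> < real n" using \<open>K < real N\<close> \<open>N \<le> n\<close> by simp
          finally show ?thesis .
        qed
        then show "X (real n) s \<omega> = Y s \<omega>" using elim(1) \<open>s \<in> {0..t}\<close> by simp
      qed
    qed
    show ?case
    proof (cases "ruin_time Y \<omega> = \<infinity>")
      case False
      obtain s where s: "0 \<le> s" "ruin_time Y \<omega> = ereal s" "Y s \<omega> \<le> 0"
        using ruin_time_attained[of Y \<omega>, OF cont False] .
      show ?thesis
      proof (rule tendsto_eventually, use agree[of s] in eventually_elim)
        case (elim n)
        have "ruin_time (X (real n)) \<omega> = ereal s"
        proof (rule antisym)
          show "ruin_time (X (real n)) \<omega> \<le> ereal s" using elim s by (intro ruin_time_le) auto
          show "ereal s \<le> ruin_time (X (real n)) \<omega>"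
          proof (rule ruin_time_ge)
            fix u assume u: "0 \<le> u" "X (real n) u \<omega> \<le> 0"
            show "ereal s \<le> ereal u"
            proof (rule ccontr)
              assume "\<not> ereal s \<le> ereal u"
              then have "u < s" by simp
              then have "Y u \<omega> \<le> 0" using elim u by simp
              then have "ruin_time Y \<omega> \<le> ereal u" by (rule ruin_time_le[OF u(1)])
              then show False using s(2) \<open>u < s\<close> by simp
            qed
          qed
        qed
        then show ?case using s by simp
      qed
    next
      case True
      have Ypos: "0 < Y s \<omega>" if "0 \<le> s" for s
        using ruin_time_le[OF that, of Y \<omega>] True by force
      have le: "\<forall>\<^sub>F n in sequentially. discount \<beta> (ruin_time (X (real n)) \<omega>) \<le> exp (- \<beta> * real m)" for m
        using agree[of "real m"]
      proof eventually_elim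
        case (elim n)
        have "ereal (real m) \<le> ruin_time (X (real n)) \<omega>"
        proof (rule ruin_time_ge, rule ccontr)
          fix u assume u: "0 \<le> u" "X (real n) u \<omega> \<le> 0" "\<not> ereal (real m) \<le> ereal u"
          then have "Y u \<omega> \<le> 0" using elim by simp
          then show False using Ypos[OF u(1)] by simp
        qed
        then have "discount \<beta> (ruin_time (X (real n)) \<omega>) \<le> discount \<beta> (ereal (real m))"
          by (intro discount_antimono[OF \<open>\<beta> > 0\<close>]) simp_all
        then show ?case by simp
      qed
      have "(\<lambda>m. exp (- \<beta>) ^ m) \<longlonglongrightarrow> 0" using \<open>\<beta> > 0\<close> by (intro LIMSEQ_power_zero) simp
      then have lim: "(\<lambda>m. exp (- \<beta> * real m)) \<longlonglongrightarrow> 0"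
        by (simp add: exp_of_nat_mult[symmetric] mult.commute)
      have "(\<lambda>n. discount \<beta> (ruin_time (X (real n)) \<omega>)) \<longlonglongrightarrow> 0"
      proof (rule order_tendstoI)
        fix e :: real assume "e < 0"
        then show "\<forall>\<^sub>F n in sequentially. e < discount \<beta> (ruin_time (X (real n)) \<omega>)"
          by (intro always_eventually) (simp add: less_le_trans[OF _ discount_nonneg])
      next
        fix e :: real assume "0 < e"
        then have "\<forall>\<^sub>F m in sequentially. exp (- \<beta> * real m) < e" by (rule order_tendstoD(2)[OF lim])
        then obtain m where "exp (- \<beta> * real m) < e" by (auto simp: eventually_sequentially)
        with le[of m] show "\<forall>\<^sub>F n in sequentially. discount \<beta> (ruin_time (X (real n)) \<omega>) < e"
          by (auto elim: eventually_mono)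
      qed
      then show ?thesis using True by (simp add: discount_def)
    qed
  qed
  have "(\<lambda>n. ruin_transform M \<beta> (X (real n))) \<longlonglongrightarrow> ruin_transform M \<beta> Y"
    unfolding ruin_transform_def
  proof (rule integral_dominated_convergence[where w = "\<lambda>_. 1"])
    show "AE \<omega> in M. norm (discount \<beta> (ruin_time (X (real n)) \<omega>)) \<le> 1" for n
      using discount_le_1[OF \<open>\<beta> > 0\<close> ruin_time_nonneg, of "X (real n)"] by (intro AE_I2) simp
  qed (use conv borel_measurable_integrable[OF discount_ruin_integrable[OF \<open>\<beta> > 0\<close>]] Y cX in auto)
  moreover have "ruin_transform M \<beta> Y < \<alpha>"
  proof -
    have "(\<integral>\<^sup>+\<omega>. ennreal (discount \<beta> (ruin_time Y \<omega>)) \<partial>M) \<le> ennreal (exp (r * (x - a)))"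
    proof (rule nn_integral_discount_ruin_le[OF \<open>\<beta> > 0\<close> \<open>a > 0\<close>])
      show "\<forall>\<^sub>F n in sequentially.
        (\<Sum>k. ennreal (exp (- \<beta> * (real k * (1 / real (Suc n))))) * emeasure M (grid_hit M (1 / real (Suc
            n)) a Y k))
          \<le> ennreal (exp (r * (x - a)))"
        by (rule always_eventually, rule allI, rule grid_hit_drifted_le[OF _ r(1) r(2)[symmetric] Y_def W]) simp
    qed (use continuous_adaptedD[OF Y] in blast)+
    then have "ruin_transform M \<beta> Y \<le> exp (r * (x - a))"
      unfolding ennreal_ruin_transform[OF \<open>\<beta> > 0\<close> Y, symmetric] by simp
    then show ?thesis using \<alpha> by simp
  qed
  ultimately show ?thesis by (rule order_tendstoD(2))
qed

end

section \<open>Existence of the equilibrium pair\<close>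

text \<open>The exponent is strictly decreasing to the left of its smaller root, and a step of size \<open>1\<close> gives one
  admissible choice of \<open>c\<close> for the Lipschitz estimate.\<close>

lemma exponent_root_minus:
  assumes "\<sigma> > 0" "k > 0"
  shows "exponent m \<sigma> (root_minus m \<sigma> k) = k"
    and "k < exponent m \<sigma> (root_minus m \<sigma> k - 1)"
proof -
  define r where "r = root_minus m \<sigma> k"
  have q: "\<sigma>^2 / 2 * r^2 + m * r - k = 0" unfolding r_def by (rule root_quadratic(2)[OF assms])
  then show eq: "exponent m \<sigma> (root_minus m \<sigma> k) = k" unfolding r_def[symmetric] exponent_def by simp
  have "0 \<le> m^2 / \<sigma>^4 + 2 * k / \<sigma>^2" using assms by (intro add_nonneg_nonneg) auto
  then have "0 \<le> sqrt (m^2 / \<sigma>^4 + 2 * k / \<sigma>^2)" by (rule real_sqrt_ge_zero)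
  then have "r \<le> - (m / \<sigma>^2)" unfolding r_def root_minus_def by linarith
  then have "\<sigma>^2 * r \<le> \<sigma>^2 * (- (m / \<sigma>^2))" by (rule mult_left_mono) simp
  then have "\<sigma>^2 * r + m \<le> 0" using assms by simp
  moreover have "exponent m \<sigma> (r - 1) = exponent m \<sigma> r - (\<sigma>^2 * r + m) + \<sigma>^2 / 2"
    unfolding exponent_def by (simp add: power2_eq_square field_simps)
  moreover have "\<sigma>^2 / 2 > 0" using assms by simp
  ultimately show "k < exponent m \<sigma> (root_minus m \<sigma> k - 1)"
    using eq unfolding r_def by linarith
qed

theorem proposition3:
  fixes \<mu> \<sigma> \<delta> \<beta> L \<alpha> x :: real
    and M :: "'a measure" and F :: "real \<Rightarrow> 'a measure" and W :: "real \<Rightarrow> 'a \<Rightarrow> real"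
    and X :: "real \<Rightarrow> real \<Rightarrow> real \<Rightarrow> 'a \<Rightarrow> real"
  assumes "\<sigma> > 0" and "\<delta> > 0" and "\<beta> > 0" and "L > 0"
    and "brownian_motion M F W"
    and "\<And>y b. y \<ge> 0 \<Longrightarrow> b \<ge> 0 \<Longrightarrow> threshold_sde_solution M F W \<mu> \<sigma> L y b (X y b)"
    and "0 < \<alpha>" and "\<alpha> \<le> 1"
    and "x > ln \<alpha> / root_minus \<mu> \<sigma> \<beta>"
  shows "\<exists>b lam. b \<ge> 0 \<and> lam \<le> 0 \<and> equilibrium_threshold \<mu> \<sigma> \<delta> \<beta> L lam b \<and>
           ruin_transform M \<beta> (X x b) \<le> \<alpha> \<and>
           lam * (ruin_transform M \<beta> (X x b) - \<alpha>) = 0"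
proof -
  interpret brownian M F W by unfold_locales (rule assms(5))
  define r where "r = root_minus \<mu> \<sigma> \<beta>"
  have r: "r < 0" "exponent \<mu> \<sigma> r = \<beta>" "\<beta> < exponent \<mu> \<sigma> (r - 1)"
    unfolding r_def using assms(1,3) by (simp_all add: root_minus_neg exponent_root_minus)
  have "ln \<alpha> \<le> 0" using assms(7,8) by simp
  then have "0 \<le> ln \<alpha> / r" using r(1) by (simp add: divide_nonpos_neg)
  then have "x > 0" using assms(9) unfolding r_def by linarith
  have X: "threshold_sde_solution M F W \<mu> \<sigma> L x b (X x b)" if "b \<ge> 0" for b
    using assms(6) \<open>x > 0\<close> that by simp
  define w where "w = (\<lambda>b. ruin_transform M \<beta> (X x b))"
  have "(3 * \<bar>r - 1\<bar>)-lipschitz_on {0..} w"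
    unfolding w_def by (rule ruin_transform_Lipschitz[OF assms(3,4) _ r(3) X]) (use r(1) in simp_all)
  then have cont: "continuous_on {0..} w" by (rule lipschitz_on_continuous_on)
  obtain b0 where b0: "b0 \<ge> 0" "equilibrium_threshold \<mu> \<sigma> \<delta> \<beta> L 0 b0" "threshold_fun \<mu> \<sigma> \<delta> \<beta> L 0 b0 \<le> 0"
    using equilibrium_threshold_multiplier_0[OF assms(1-4)] .
  show ?thesis
  proof (cases "w b0 \<le> \<alpha>")
    case True
    then show ?thesis using b0(1,2) unfolding w_def by (intro exI[of _ b0] exI[of _ 0]) simp
  next
    case False
    \<comment> \<open>Half of the distance between \<open>x\<close> and its lower bound \<open>q\<close> serves as the grid level \<open>a\<close>.\<close>
    define q where "q = ln \<alpha> / r"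
    define a where "a = (x - q) / 2"
    have "q < x" using assms(9) by (simp add: q_def r_def)
    then have "a > 0" "q < x - a" by (simp_all add: a_def field_simps)
    then have "r * (x - a) < r * q" using r(1) by (simp add: mult_less_cancel_left_neg)
    also have "r * q = ln \<alpha>" using r(1) by (simp add: q_def)
    finally have "exp (r * (x - a)) < exp (ln \<alpha>)" by simp
    then have e: "exp (r * (x - a)) < \<alpha>" using assms(7) by simp
    have "\<forall>\<^sub>F n in sequentially. w (real n) < \<alpha>"
      unfolding w_def by (rule ruin_transform_large_threshold[OF assms(3,4) r(1,2) X \<open>a > 0\<close> e])
    moreover have "\<forall>\<^sub>F n in sequentially. b0 < real n"
      using filterlim_real_sequentially unfolding filterlim_at_top_dense by blast
    ultimately have "\<forall>\<^sub>F n in sequentially. w (real n) < \<alpha> \<and> b0 < real n" by (rule eventually_conj)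
    then obtain n where n: "w (real n) < \<alpha>" "b0 < real n" by (auto simp: eventually_sequentially)
    have "continuous_on {b0..real n} w" using cont b0(1) by (auto elim: continuous_on_subset)
    then obtain b where b: "b0 \<le> b" "w b = \<alpha>"
      using IVT2'[of w "real n" \<alpha> b0] n False by auto
    have "b0 < b" using b False by (cases "b = b0") auto
    obtain lam where "lam \<le> 0" "equilibrium_threshold \<mu> \<sigma> \<delta> \<beta> L lam b"
      using equilibrium_threshold_above[OF assms(1-4) b0(1,3) \<open>b0 < b\<close>] .
    then show ?thesis using b b0(1) unfolding w_def by (intro exI[of _ b] exI[of _ lam]) simp
  qed
qed

end
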